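(* Let $\mathcal{P}$ be an order-hereditary property of $k$-colourings with $\mathcal{P}_n\neq\emptyset$ for all $n$, and suppose $\mathcal{S}$ is a stability family for $\mathcal{P}$. Then for all $\varepsilon>0$ there exists $n_0\in\mathbb{N}$ such that for all $n\ge n_0$ there are at most $\varepsilon|\mathcal{P}_n|$ colourings $c\in\mathcal{P}_n$ with $\rho(\langle\mathcal{S}\rangle,c)>\varepsilon\binom n2$.
   Context: $K_n$ is the complete graph on $[n]$; a $k$-colouring of $K_n$ is a map $E(K_n)\to[k]$. For $m\le n$, $\binom{K_n}{K_m}$ is the set of order-preserving injections $\phi:[m]\to[n]$; $c_{|\phi}(ij)=c(\phi(i)\phi(j))$. An order-hereditary property is a sequence $(\mathcal{P}_n)$ of families of $k$-colourings of $K_n$ with $c_{|\phi}\in\mathcal{P}_m$ whenever $c\in\mathcal{P}_n$, $\phi\in\binom{K_n}{K_m}$. A template for $K_n$ is $t:E(K_n)\to2^{[k]}\setminus\{\emptyset\}$, $t_{|\phi}(ij)=t(\phi(i)\phi(j))$, $\langle t\rangle$ the set of colourings $c$ with $c(e)\in t(e)$ for all $e$, $\mathrm{Ent}(t)=\sum_e\log_k|t(e)|$, $\mathrm{ex}(n,\mathcal{P})=\max\{\mathrm{Ent}(t):\langle t\rangle\subseteq\mathcal{P}_n\}$, and $\pi(\mathcal{P})=\lim_n\mathrm{ex}(n,\mathcal{P})/\binom n2$ (this limit exists). The edit distance $\rho(t,t')$ between two templates of $K_n$ is the number of edges $e$ with $t(e)\neq t'(e)$ (colourings are regarded as templates with singleton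 palettes). For a family $\mathcal{S}$ of templates (of various $K_n$), $\langle\mathcal{S}\rangle$ is the set of all realisations of members of $\mathcal{S}$, and for a $k$-colouring $c$ of $K_n$, $\rho(\langle\mathcal{S}\rangle,c)$ is the minimum of $\rho(c',c)$ over colourings $c'$ of $K_n$ in $\langle\mathcal{S}\rangle$, or $\binom n2$ if there is none. $\mathcal{S}$ is a stability family for $\mathcal{P}$ if for all $\varepsilon>0$ there exist $\delta>0$ and $m,n_0\in\mathbb{N}$ such that for all $n\ge n_0$, every template $t$ for $K_n$ with (i) $\mathrm{Ent}(t)\ge(\pi(\mathcal{P})-\delta)\binom n2$ and (ii) at most $\delta\binom nm$ pairs $(\phi,c)$ with $\phi\in\binom{K_n}{K_m}$, $c$ a $k$-colouring of $K_m$ with $c\notin\mathcal{P}_m$, and $c\in\langle t_{|\phi}\rangle$, satisfies $\rho(s,t)\le\varepsilon\binom n2$ for some template $s\in\mathcal{S}$ of $K_n$. *)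

theory Defs
  imports Complex_Main "HOL-Library.FuncSet"
begin

type_synonym edge = "nat set"
type_synonym colouring = "edge \<Rightarrow> nat"
type_synonym template = "edge \<Rightarrow> nat set"

definition K_edges :: "nat \<Rightarrow> edge set" where
  "K_edges n = {e. e \<subseteq> {1..n} \<and> card e = 2}"

definition colourings :: "nat \<Rightarrow> nat \<Rightarrow> colouring set" where
  "colourings k n = K_edges n \<rightarrow>\<^sub>E {1..k}"

definition templates :: "nat \<Rightarrow> nat \<Rightarrow> template set" where
  "templates k n = K_edges n \<rightarrow>\<^sub>E (Pow {1..k} - {{}})"

definition order_injections :: "nat \<Rightarrow> nat \<Rightarrow> (nat \<Rightarrow> nat) set" where
  "order_injections m n =
     {\<phi> \<in> {1..m} \<rightarrow>\<^sub>E {1..n}. inj_on \<phi> {1..m} \<and> mono_on {1..m} \<phi>}"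

text \<open>The restriction along \<open>\<phi>\<close>, used both for colourings and for templates.\<close>

definition pullback :: "nat \<Rightarrow> (nat \<Rightarrow> nat) \<Rightarrow> (edge \<Rightarrow> 'a) \<Rightarrow> edge \<Rightarrow> 'a" where
  "pullback m \<phi> c = (\<lambda>e \<in> K_edges m. c (\<phi> ` e))"

text \<open>Properties of colourings and families of templates are graded by the number of vertices,
  since an extensional function on the edges does not by itself determine \<open>n\<close>.\<close>

definition order_hereditary :: "nat \<Rightarrow> (nat \<Rightarrow> colouring set) \<Rightarrow> bool" where
  "order_hereditary k P \<longleftrightarrow>
     (\<forall>n. P n \<subseteq> colourings k n) \<and>
     (\<forall>m n. \<forall>c \<in> P n. \<forall>\<phi> \<in> order_injections m n. pullback m \<phi> c \<in> P m)"

definition realisations :: "nat \<Rightarrow> nat \<Rightarrow> template \<Rightarrow> colouring set" where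
  "realisations k n t = {c \<in> colourings k n. \<forall>e \<in> K_edges n. c e \<in> t e}"

definition Ent :: "nat \<Rightarrow> nat \<Rightarrow> template \<Rightarrow> real" where
  "Ent k n t = (\<Sum>e \<in> K_edges n. log (real k) (real (card (t e))))"

definition ex_ent :: "nat \<Rightarrow> (nat \<Rightarrow> colouring set) \<Rightarrow> nat \<Rightarrow> real" where
  "ex_ent k P n = Max {Ent k n t | t. t \<in> templates k n \<and> realisations k n t \<subseteq> P n}"

definition entropy_density :: "nat \<Rightarrow> (nat \<Rightarrow> colouring set) \<Rightarrow> real" where
  "entropy_density k P = lim (\<lambda>n. ex_ent k P n / real (n choose 2))"

definition edit_dist :: "nat \<Rightarrow> template \<Rightarrow> template \<Rightarrow> nat" where
  "edit_dist n t t' = card {e \<in> K_edges n. t e \<noteq> t' e}"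

definition as_template :: "nat \<Rightarrow> colouring \<Rightarrow> template" where
  "as_template n c = (\<lambda>e \<in> K_edges n. {c e})"

definition family_realisations ::
    "nat \<Rightarrow> (nat \<Rightarrow> template set) \<Rightarrow> nat \<Rightarrow> colouring set" where
  "family_realisations k S n = (\<Union>t \<in> S n. realisations k n t)"

definition dist_to_family :: "nat \<Rightarrow> nat \<Rightarrow> (nat \<Rightarrow> template set) \<Rightarrow> colouring \<Rightarrow> nat" where
  "dist_to_family k n S c =
     (if family_realisations k S n = {} then n choose 2
      else Min ((\<lambda>c'. edit_dist n (as_template n c') (as_template n c))
                  ` family_realisations k S n))"

definition bad_pairs ::
    "nat \<Rightarrow> (nat \<Rightarrow> colouring set) \<Rightarrow> nat \<Rightarrow> nat \<Rightarrow> template \<Rightarrow> ((nat \<Rightarrow> nat) \<times> colouring) set" where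
  "bad_pairs k P m n t =
     {(\<phi>, c). \<phi> \<in> order_injections m n \<and> c \<in> colourings k m \<and> c \<notin> P m \<and>
              c \<in> realisations k m (pullback m \<phi> t)}"

definition stability_family ::
    "nat \<Rightarrow> (nat \<Rightarrow> colouring set) \<Rightarrow> (nat \<Rightarrow> template set) \<Rightarrow> bool" where
  "stability_family k P S \<longleftrightarrow>
     (\<forall>n. S n \<subseteq> templates k n) \<and>
     (\<forall>\<epsilon>>0. \<exists>\<delta>>0. \<exists>m n0. \<forall>n\<ge>n0. \<forall>t \<in> templates k n.
        Ent k n t \<ge> (entropy_density k P - \<delta>) * real (n choose 2) \<longrightarrow>
        real (card (bad_pairs k P m n t)) \<le> \<delta> * real (n choose m) \<longrightarrow>
        (\<exists>s \<in> S n. real (edit_dist n s t) \<le> \<epsilon> * real (n choose 2)))"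

end

theory Submission
  imports Defs
begin

text \<open>
  Instead of hypergraph containers, the proof uses the weak (Frieze--Kannan) regularity lemma.
  Given a colouring \<open>c \<in> P n\<close>, apply it to the functions \<open>(x, y) \<mapsto> [x < y \<and> c {x, y} = q]\<close>, which build
  in the order of the vertices, and let \<open>t {x, y}\<close>, for \<open>x < y\<close>, consist of the colours of density at
  least \<open>\<eta>\<close> between the cells of \<open>x\<close> and \<open>y\<close>. Then \<open>c\<close> is a realisation of \<open>t\<close> up to few edges, and
  by the counting lemma many bad pairs for \<open>t\<close> would force a forbidden pattern in \<open>c\<close>. There are only
  \<open>exp (O n)\<close> such templates. Those of entropy below \<open>(\<pi> - \<delta>) (n choose 2)\<close> have, even with their
  perturbations, negligibly many realisations compared with \<open>|P n| \<ge> k powr (\<pi> (n choose 2))\<close>; all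
  the others are close to \<open>S n\<close> by stability.
\<close>

text \<open>Weak regularity suffices because a bad pair involves only m vertices, and m comes from
  the stability hypothesis before any regularity parameter is chosen: a cut error \<theta> n^2
  becomes an error of at most (m choose 2) \<theta> n^m in the weighted count of an m-vertex
  pattern. One-sided cut bounds are enough, since the true count of a forbidden pattern is exactly
  0. The threshold \<eta> converts this into a bound on copies all of whose pairs are dense: each
  has weight at least \<eta>^(m choose 2), so \<theta> has to be small compared with that power. The
  cells may mix small and large vertices freely, because the order sits in the functions and not in
  the partition.

  The number of cells is bounded independently of n; this keeps the number of templates at exp (O
  n), while the entropy deficit gains a factor exp (- c n^2). Constants are fixed in this order:
  \<delta> and m from stability at half the given distance, then \<gamma>, the proportion of edits
  allowed, then \<eta>, then the cut error, then the number of cells.\<close>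

section \<open>Weak regularity\<close>

text \<open>Conditional expectation on the partition of \<open>A\<close> into the fibres of
  \<open>p\<close>. A partition is encoded by a labelling so that coarsening is composition of maps.
  An empty fibre yields 0 through division by zero, so bounds in [0, 1] hold even for
  \<open>z\<close> outside \<open>A\<close>.\<close>

definition cell_avg :: "'a set \<Rightarrow> ('a \<Rightarrow> 'l) \<Rightarrow> ('a \<Rightarrow> real) \<Rightarrow> 'a \<Rightarrow> real" where
  "cell_avg A p f z = (\<Sum>w\<in>{w\<in>A. p w = p z}. f w) / real (card {w\<in>A. p w = p z})"

text \<open>The squared norm of the conditional expectation, left unnormalised: the potential that
  grows in the regularity argument.\<close>

definition energy :: "'a set \<Rightarrow> ('a \<Rightarrow> 'l) \<Rightarrow> ('a \<Rightarrow> real) \<Rightarrow> real" where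
  "energy A p f = (\<Sum>z\<in>A. (cell_avg A p f z)\<^sup>2)"

lemma cell_avg_factor: "\<exists>g. \<forall>z. cell_avg A p f z = g (p z)"
  by (rule exI[of _ "\<lambda>l. (\<Sum>w\<in>{w\<in>A. p w = l}. f w) / real (card {w\<in>A. p w = l})"])
     (simp add: cell_avg_def)

text \<open>Averaging is the orthogonal projection onto functions constant on cells: within one cell
  both sums are the sum of \<open>f\<close> there times the constant value of
  \<open>h\<close>.\<close>

lemma sum_cell_avg_mult:
  assumes "finite A"
  shows "(\<Sum>z\<in>A. cell_avg A p f z * h (p z)) = (\<Sum>z\<in>A. f z * h (p z))"
proof -
  have "(\<Sum>z\<in>{z\<in>A. p z = l}. cell_avg A p f z * h (p z)) = (\<Sum>z\<in>{z\<in>A. p z = l}. f z * h (p z))"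
    if "l \<in> p ` A" for l
  proof -
    let ?C = "{z\<in>A. p z = l}"
    have ne: "card ?C \<noteq> 0"
      using that assms by auto
    have "(\<Sum>z\<in>?C. cell_avg A p f z * h (p z)) = (\<Sum>z\<in>?C. (\<Sum>w\<in>?C. f w) / real (card ?C) * h l)"
      by (intro sum.cong) (auto simp: cell_avg_def)
    also have "\<dots> = (\<Sum>w\<in>?C. f w) * h l"
      using ne by simp
    also have "\<dots> = (\<Sum>z\<in>?C. f z * h (p z))"
      by (simp add: sum_distrib_right)
    finally show ?thesis .
  qed
  then have "(\<Sum>l\<in>p ` A. \<Sum>z\<in>{z\<in>A. p z = l}. cell_avg A p f z * h (p z))
      = (\<Sum>l\<in>p ` A. \<Sum>z\<in>{z\<in>A. p z = l}. f z * h (p z))"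
    by (rule sum.cong[OF refl])
  then show ?thesis
    unfolding sum.group[OF assms finite_imageI[OF assms] subset_refl] .
qed

lemma cell_avg_bounds:
  assumes "\<And>z. z \<in> A \<Longrightarrow> 0 \<le> f z \<and> f z \<le> 1"
  shows "0 \<le> cell_avg A p f z" and "cell_avg A p f z \<le> 1"
proof -
  let ?C = "{w\<in>A. p w = p z}"
  show "0 \<le> cell_avg A p f z"
    unfolding cell_avg_def using assms by (intro divide_nonneg_nonneg sum_nonneg) auto
  have "(\<Sum>w\<in>?C. f w) \<le> (\<Sum>w\<in>?C. 1)"
    using assms by (intro sum_mono) auto
  then show "cell_avg A p f z \<le> 1"
    unfolding cell_avg_def by (simp add: divide_le_eq)
qed

lemma energy_le_card:
  assumes "\<And>z. z \<in> A \<Longrightarrow> 0 \<le> f z \<and> f z \<le> 1"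
  shows "energy A p f \<le> real (card A)"
proof -
  have "energy A p f \<le> (\<Sum>z\<in>A. 1)"
    unfolding energy_def
    using cell_avg_bounds[of A f p, OF assms] by (intro sum_mono) (simp add: power_le_one)
  then show ?thesis by simp
qed

text \<open>Pythagoras: the coarse average is constant on the cells of \<open>p'\<close>, so by the
  projection property its inner product with the fine average is its own squared norm.\<close>

lemma energy_refine:
  assumes "finite A" and ref: "p = g \<circ> p'"
  shows "energy A p' f = energy A p f + (\<Sum>z\<in>A. (cell_avg A p' f z - cell_avg A p f z)\<^sup>2)"
proof -
  obtain h where h: "\<And>z. cell_avg A p f z = h (p z)"
    using cell_avg_factor[of A p f] by blast
  have "(\<Sum>z\<in>A. cell_avg A p' f z * cell_avg A p f z) = (\<Sum>z\<in>A. cell_avg A p' f z * (h \<circ> g) (p' z))"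
    unfolding h by (simp add: ref)
  also have "\<dots> = (\<Sum>z\<in>A. f z * h (p z))"
    using assms sum_cell_avg_mult[of A p' f "h \<circ> g"] by simp
  also have "\<dots> = (\<Sum>z\<in>A. cell_avg A p f z * cell_avg A p f z)"
    using sum_cell_avg_mult[OF assms(1), of p f h] unfolding h by simp
  finally have "(\<Sum>z\<in>A. cell_avg A p' f z * cell_avg A p f z) = energy A p f"
    by (simp add: energy_def power2_eq_square)
  moreover have "(\<Sum>z\<in>A. (cell_avg A p' f z - cell_avg A p f z)\<^sup>2)
      = energy A p' f + energy A p f - 2 * (\<Sum>z\<in>A. cell_avg A p' f z * cell_avg A p f z)"
    by (simp add: energy_def power2_diff sum.distrib sum_subtractf sum_distrib_left mult.assoc)
  ultimately show ?thesis by simp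
qed

text \<open>\<open>S\<close> is a union of fine cells, so the fine average and \<open>f\<close> have
  the same sum over it. The excess of the coarse average over \<open>f\<close> is therefore a
  correlation between the indicator of \<open>S\<close> and the difference of the two averages,
  which forces this difference to have large norm.\<close>

lemma energy_increment:
  assumes fin: "finite A" and ref: "p = g \<circ> p'" and "0 \<le> \<epsilon>"
    and S: "S = {z\<in>A. p' z \<in> L}"
    and irregular: "(\<Sum>z\<in>S. cell_avg A p f z - f z) > \<epsilon> * real (card A)"
  shows "energy A p' f \<ge> energy A p f + \<epsilon>\<^sup>2 * real (card A)"
proof -
  define u where "u z = cell_avg A p f z - cell_avg A p' f z" for z
  define i where "i z = (if z \<in> S then 1 else 0 :: real)" for z
  have restr: "(\<Sum>z\<in>A. h z * i z) = sum h S" for h :: "'a \<Rightarrow> real"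
    using fin by (auto simp: i_def S if_distrib sum.If_cases Int_def cong: if_cong intro!: sum.cong)
  have "(\<Sum>z\<in>A. cell_avg A p' f z * i z) = (\<Sum>z\<in>A. f z * i z)"
  proof -
    have "(\<Sum>z\<in>A. h z * i z) = (\<Sum>z\<in>A. h z * (\<lambda>l. if l \<in> L then 1 else 0) (p' z))" for h :: "'a \<Rightarrow> real"
      by (intro sum.cong) (auto simp: i_def S)
    then show ?thesis
      using sum_cell_avg_mult[OF fin, of p' f "\<lambda>l. if l \<in> L then 1 else 0"] by simp
  qed
  then have "sum (cell_avg A p' f) S = sum f S"
    by (simp add: restr)
  then have "(\<Sum>z\<in>A. u z * i z) > \<epsilon> * real (card A)"
    using irregular by (simp add: restr u_def sum_subtractf)
  then have "\<epsilon> * (\<Sum>z\<in>A. u z * i z) \<ge> \<epsilon> * (\<epsilon> * real (card A))"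
    using \<open>0 \<le> \<epsilon>\<close> by (intro mult_left_mono) auto
  moreover have "(\<Sum>z\<in>A. (i z)\<^sup>2) \<le> (\<Sum>z\<in>A. 1)"
    by (intro sum_mono) (auto simp: i_def)
  then have "\<epsilon>\<^sup>2 * (\<Sum>z\<in>A. (i z)\<^sup>2) \<le> \<epsilon>\<^sup>2 * real (card A)"
    by (intro mult_left_mono) auto
  \<comment> \<open>Cauchy-Schwarz by completing a square: the expansion gives that the sum of u^2
    is at least 2 \<epsilon>^2 |A| - \<epsilon>^2 |A|.\<close>
  moreover have "0 \<le> (\<Sum>z\<in>A. (u z - \<epsilon> * i z)\<^sup>2)"
    by (intro sum_nonneg) auto
  moreover have "(\<Sum>z\<in>A. (u z - \<epsilon> * i z)\<^sup>2)
      = (\<Sum>z\<in>A. (u z)\<^sup>2) - 2 * (\<epsilon> * (\<Sum>z\<in>A. u z * i z)) + \<epsilon>\<^sup>2 * (\<Sum>z\<in>A. (i z)\<^sup>2)"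
    by (simp add: power2_diff sum.distrib sum_subtractf sum_distrib_left algebra_simps)
  ultimately have "(\<Sum>z\<in>A. (u z)\<^sup>2) \<ge> \<epsilon>\<^sup>2 * real (card A)"
    by (simp add: power2_eq_square)
  then show ?thesis
    using energy_refine[OF fin ref, of f] by (simp add: u_def power2_commute)
qed

text \<open>All functions share one partition. A violated cut for one of them, used to refine it,
  raises that energy by \<epsilon>^2 |V|^2 and lowers no other. The total never exceeds |Q| |V|^2,
  so by the choice of \<open>T\<close> there cannot be \<open>T\<close> such rounds; each multiplies
  the number of labels by 4.\<close>

lemma weak_regularity:
  fixes V :: "'a set" and f :: "'c \<Rightarrow> 'a \<times> 'a \<Rightarrow> real"
  assumes fin: "finite V" "V \<noteq> {}" "finite Q" and "0 \<le> \<epsilon>" and T: "real T * \<epsilon>\<^sup>2 > real (card Q)"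
    and f01: "\<And>q z. 0 \<le> f q z \<and> f q z \<le> 1"
  shows "\<exists>p :: 'a \<Rightarrow> nat. (\<forall>x. p x < 4 ^ T) \<and>
    (\<forall>q\<in>Q. \<forall>U W. U \<subseteq> V \<longrightarrow> W \<subseteq> V \<longrightarrow>
      (\<Sum>z\<in>U \<times> W. cell_avg (V \<times> V) (map_prod p p) (f q) z - f q z) \<le> \<epsilon> * (real (card V))\<^sup>2)"
proof (rule ccontr)
  assume irregular: "\<not> ?thesis"
  let ?A = "V \<times> V"
  let ?N = "(real (card V))\<^sup>2"
  have finA: "finite ?A" and cardA: "real (card ?A) = ?N"
    using fin by (auto simp: card_cartesian_product power2_eq_square)
  have "j \<le> T \<Longrightarrow> \<exists>p :: 'a \<Rightarrow> nat. (\<forall>x. p x < 4 ^ j) \<and>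
      (\<Sum>q\<in>Q. energy ?A (map_prod p p) (f q)) \<ge> real j * \<epsilon>\<^sup>2 * ?N" for j
  proof (induction j)
    case 0
    show ?case
      by (rule exI[of _ "\<lambda>_. 0"]) (simp add: energy_def sum_nonneg)
  next
    case (Suc j)
    then obtain p :: "'a \<Rightarrow> nat" where p: "\<And>x. p x < 4 ^ j"
      and E: "(\<Sum>q\<in>Q. energy ?A (map_prod p p) (f q)) \<ge> real j * \<epsilon>\<^sup>2 * ?N"
      by auto
    have "(4::nat) ^ j \<le> 4 ^ T"
      using Suc.prems by (intro power_increasing) auto
    then have "\<forall>x. p x < 4 ^ T"
      using p less_le_trans by blast
    then obtain q U W where q: "q \<in> Q" and UW: "U \<subseteq> V" "W \<subseteq> V"
      and big: "(\<Sum>z\<in>U \<times> W. cell_avg ?A (map_prod p p) (f q) z - f q z) > \<epsilon> * ?N"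
      using irregular by (meson not_le)
    \<comment> \<open>The last base-4 digit records membership in \<open>U\<close> and in
      \<open>W\<close>; \<open>div 4\<close> recovers the old label. Both are recorded because the
      same labelling is used on both coordinates.\<close>
    define p' :: "'a \<Rightarrow> nat" where "p' x = 4 * p x + 2 * of_bool (x \<in> U) + of_bool (x \<in> W)" for x
    have p'U: "x \<in> U \<longleftrightarrow> p' x mod 4 \<in> {2, 3}" for x
      by (auto simp: p'_def)
    have p'W: "x \<in> W \<longleftrightarrow> p' x mod 4 \<in> {1, 3}" for x
      by (auto simp: p'_def)
    have ref: "map_prod p p = map_prod (\<lambda>l. l div 4) (\<lambda>l. l div 4) \<circ> map_prod p' p'"
      by (auto simp: p'_def fun_eq_iff)
    have S: "U \<times> W = {z\<in>?A. map_prod p' p' z \<in> {(l, l'). l mod 4 \<in> {2, 3} \<and> l' mod 4 \<in> {1, 3}}}"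
      using UW by (auto simp: p'U p'W)
    have inc: "energy ?A (map_prod p' p') (f q) \<ge> energy ?A (map_prod p p) (f q) + \<epsilon>\<^sup>2 * ?N"
      using energy_increment[OF finA ref \<open>0 \<le> \<epsilon>\<close> S] big by (simp add: cardA)
    have mono: "energy ?A (map_prod p' p') (f r) \<ge> energy ?A (map_prod p p) (f r)" for r
      using energy_refine[OF finA ref, of "f r"] by (simp add: sum_nonneg)
    have "(\<Sum>q\<in>Q. energy ?A (map_prod p' p') (f q))
        = energy ?A (map_prod p' p') (f q) + (\<Sum>r\<in>Q - {q}. energy ?A (map_prod p' p') (f r))"
      using fin q by (simp add: sum.remove)
    also have "\<dots> \<ge> energy ?A (map_prod p p) (f q) + \<epsilon>\<^sup>2 * ?N + (\<Sum>r\<in>Q - {q}. energy ?A (map_prod p p) (f r))"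
      using inc mono by (intro add_mono sum_mono) auto
    also have "energy ?A (map_prod p p) (f q) + \<epsilon>\<^sup>2 * ?N + (\<Sum>r\<in>Q - {q}. energy ?A (map_prod p p) (f r))
        = (\<Sum>q\<in>Q. energy ?A (map_prod p p) (f q)) + \<epsilon>\<^sup>2 * ?N"
      using fin q by (simp add: sum.remove)
    finally have "(\<Sum>q\<in>Q. energy ?A (map_prod p' p') (f q)) \<ge> real (Suc j) * \<epsilon>\<^sup>2 * ?N"
      using E by (simp add: algebra_simps)
    moreover have "p' x < 4 ^ Suc j" for x
      using p[of x] by (auto simp: p'_def of_bool_def)
    ultimately show ?case by blast
  qed
  then obtain p :: "'a \<Rightarrow> nat" where "(\<Sum>q\<in>Q. energy ?A (map_prod p p) (f q)) \<ge> real T * \<epsilon>\<^sup>2 * ?N"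
    by blast
  moreover have "(\<Sum>q\<in>Q. energy ?A (map_prod p p) (f q)) \<le> (\<Sum>q\<in>Q. ?N)"
    using energy_le_card[of ?A "f _", OF f01] unfolding cardA by (rule sum_mono)
  ultimately have "real T * \<epsilon>\<^sup>2 * ?N \<le> real (card Q) * ?N"
    by simp
  moreover have "?N > 0"
    using fin by (simp add: card_gt_0_iff)
  ultimately show False
    using T by (simp add: mult_le_cancel_right)
qed

section \<open>The counting lemma\<close>

text \<open>Fubini: all coordinates except \<open>a\<close> and \<open>b\<close> are fixed and only
  these two are summed. It serves both the cut bounds and the count of maps that send a given pair
  into a sparse set.\<close>

lemma sum_PiE_resample_le:
  fixes G :: "('i \<Rightarrow> 'a) \<Rightarrow> real"
  assumes fin: "finite V" "finite I" and ab: "a \<in> I" "b \<in> I" "a \<noteq> b"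
    and bd: "\<And>z. z \<in> (I - {a, b}) \<rightarrow>\<^sub>E V \<Longrightarrow>
      (\<Sum>y\<in>V \<times> V. G (z(a := fst y, b := snd y))) \<le> C * (real (card V))\<^sup>2"
  shows "(\<Sum>x\<in>I \<rightarrow>\<^sub>E V. G x) \<le> C * real (card V) ^ card I"
proof -
  let ?J = "I - {a, b}"
  have "(\<Sum>x\<in>I \<rightarrow>\<^sub>E V. G x)
      = (\<Sum>w\<in>(?J \<rightarrow>\<^sub>E V) \<times> (V \<times> V). G ((fst w)(a := fst (snd w), b := snd (snd w))))"
    using ab
    by (intro sum.reindex_bij_witness[where i = "\<lambda>w. (fst w)(a := fst (snd w), b := snd (snd w))"
          and j = "\<lambda>x. (x(a := undefined, b := undefined), x a, x b)"])
       (auto simp: PiE_def extensional_def Pi_def fun_eq_iff)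
  also have "\<dots> = (\<Sum>z\<in>?J \<rightarrow>\<^sub>E V. \<Sum>y\<in>V \<times> V. G (z(a := fst y, b := snd y)))"
    by (simp add: sum.cartesian_product case_prod_unfold)
  also have "\<dots> \<le> (\<Sum>z\<in>?J \<rightarrow>\<^sub>E V. C * (real (card V))\<^sup>2)"
    by (intro sum_mono bd)
  also have "\<dots> = C * (real (card V) ^ card ?J * (real (card V))\<^sup>2)"
    using fin by (simp add: card_PiE)
  also have "real (card V) ^ card ?J * (real (card V))\<^sup>2 = real (card V) ^ (card ?J + card {a, b})"
    using ab by (simp add: power_add power2_eq_square)
  also have "card ?J + card {a, b} = card I"
    using ab card_Diff_subset[of "{a, b}" I] card_mono[OF fin(2), of "{a, b}"] by simp
  finally show ?thesis .
qed

lemma sum_weighted_le: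
  fixes g u :: "'a \<Rightarrow> real"
  assumes "finite V" and "\<And>y. 0 \<le> u y \<and> u y \<le> 1"
  shows "(\<Sum>y\<in>V. u y * g y) \<le> sum g {y\<in>V. g y > 0}"
proof -
  have "u y * g y \<le> (if g y > 0 then g y else 0)" for y
    using assms(2)[of y] by (auto simp: mult_left_le_one_le mult_nonneg_nonpos)
  then have "(\<Sum>y\<in>V. u y * g y) \<le> (\<Sum>y\<in>V. if g y > 0 then g y else 0)"
    by (rule sum_mono)
  also have "\<dots> = sum g {y\<in>V. g y > 0}"
    using assms(1) by (simp add: sum.inter_filter)
  finally show ?thesis .
qed

text \<open>The form is linear in \<open>u\<close> and in \<open>v\<close> separately, so weights in
  [0, 1] do no better than indicators: \<open>u\<close> is replaced by the indicator of the points
  with positive coefficient, and then \<open>v\<close> in the same way.\<close>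

lemma bilinear_le_of_cut_le:
  fixes g :: "'a \<times> 'a \<Rightarrow> real"
  assumes fin: "finite V"
    and cut: "\<And>U W. U \<subseteq> V \<Longrightarrow> W \<subseteq> V \<Longrightarrow> sum g (U \<times> W) \<le> B"
    and u: "\<And>y. 0 \<le> u y \<and> u y \<le> 1" and v: "\<And>y. 0 \<le> v y \<and> v y \<le> 1"
  shows "(\<Sum>y\<in>V \<times> V. g y * (u (fst y) * v (snd y))) \<le> B"
proof -
  define G where "G y = (\<Sum>y'\<in>V. g (y, y') * v y')" for y
  define U where "U = {y\<in>V. G y > 0}"
  define H where "H y' = (\<Sum>y\<in>U. g (y, y'))" for y'
  define W where "W = {y'\<in>V. H y' > 0}"
  have "(\<Sum>y\<in>V \<times> V. g y * (u (fst y) * v (snd y))) = (\<Sum>y\<in>V. u y * G y)"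
    unfolding G_def sum_distrib_left
    by (simp add: sum.cartesian_product case_prod_unfold mult_ac)
  also have "\<dots> \<le> sum G U"
    unfolding U_def by (rule sum_weighted_le[OF fin u])
  also have "\<dots> = (\<Sum>y'\<in>V. v y' * H y')"
    unfolding G_def H_def sum_distrib_left by (subst sum.swap) (simp add: mult.commute)
  also have "\<dots> \<le> sum H W"
    unfolding W_def by (rule sum_weighted_le[OF fin v])
  also have "\<dots> = sum g (U \<times> W)"
    unfolding H_def by (subst sum.swap) (simp add: sum.cartesian_product case_prod_unfold)
  also have "\<dots> \<le> B"
    by (rule cut) (auto simp: U_def W_def)
  finally show ?thesis .
qed

text \<open>Once all coordinates except the two of \<open>e0\<close> are fixed, the remaining product splits into a factor
  depending on one of them and a factor depending on the other, so the cut bound applies.\<close>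

lemma hom_sum_swap_le:
  fixes h :: "'i \<times> 'i \<Rightarrow> 'a \<times> 'a \<Rightarrow> real"
  assumes fin: "finite V" "finite I"
    and D: "\<And>e. e \<in> D \<Longrightarrow> fst e \<in> I \<and> snd e \<in> I \<and> fst e \<noteq> snd e"
    and asym: "\<And>a b. (a, b) \<in> D \<Longrightarrow> (b, a) \<notin> D"
    and h: "\<And>e z. 0 \<le> h e z \<and> h e z \<le> 1"
    and e0: "e0 \<in> D"
    and cut: "\<And>U W. U \<subseteq> V \<Longrightarrow> W \<subseteq> V \<Longrightarrow> sum g (U \<times> W) \<le> \<epsilon> * (real (card V))\<^sup>2"
  shows "(\<Sum>x\<in>I \<rightarrow>\<^sub>E V. g (map_prod x x e0) * (\<Prod>e\<in>D - {e0}. h e (map_prod x x e)))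
    \<le> \<epsilon> * real (card V) ^ card I"
proof -
  obtain a b where e0_eq: "e0 = (a, b)" by (cases e0)
  have ab: "a \<in> I" "b \<in> I" "a \<noteq> b"
    using D[OF e0] by (auto simp: e0_eq)
  have finD: "finite D"
    by (rule finite_subset[of _ "I \<times> I"]) (use D fin in \<open>auto simp: mem_Times_iff\<close>)
  let ?A1 = "{e\<in>D - {e0}. fst e = a \<or> snd e = a}"
  let ?A2 = "{e\<in>D - {e0}. \<not> (fst e = a \<or> snd e = a)}"
  show ?thesis
  proof (rule sum_PiE_resample_le[OF fin ab])
    fix z :: "'i \<Rightarrow> 'a"
    define u where "u y = (\<Prod>e\<in>?A1. h e (map_prod (z(a := y)) (z(a := y)) e))" for y
    define v where "v y = (\<Prod>e\<in>?A2. h e (map_prod (z(b := y)) (z(b := y)) e))" for y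
    have split: "(\<Prod>e\<in>D - {e0}. h e (map_prod (z(a := y, b := y')) (z(a := y, b := y')) e)) = u y * v y'"
      (is "?L = _") for y y'
    proof -
      have "?L = (\<Prod>e\<in>?A1. h e (map_prod (z(a := y, b := y')) (z(a := y, b := y')) e))
          * (\<Prod>e\<in>?A2. h e (map_prod (z(a := y, b := y')) (z(a := y, b := y')) e))"
        using finD by (subst prod.union_disjoint[symmetric]) (auto intro!: prod.cong)
      also have "(\<Prod>e\<in>?A1. h e (map_prod (z(a := y, b := y')) (z(a := y, b := y')) e)) = u y"
        unfolding u_def
      proof (rule prod.cong[OF refl])
        fix e assume e: "e \<in> ?A1"
        obtain s t where st: "e = (s, t)" by (cases e)
        \<comment> \<open>With (a, b) removed and (b, a) excluded by \<open>asym\<close>, no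
          remaining pair joins \<open>a\<close> to \<open>b\<close>; a factor that involves
          \<open>a\<close> cannot see the value at \<open>b\<close>.\<close>
        have "s \<noteq> b" "t \<noteq> b"
          using e asym e0 ab by (auto simp: st e0_eq)
        then show "h e (map_prod (z(a := y, b := y')) (z(a := y, b := y')) e)
            = h e (map_prod (z(a := y)) (z(a := y)) e)"
          by (simp add: st)
      qed
      also have "(\<Prod>e\<in>?A2. h e (map_prod (z(a := y, b := y')) (z(a := y, b := y')) e)) = v y'"
        unfolding v_def by (rule prod.cong) auto
      finally show ?thesis .
    qed
    have "(\<Sum>y\<in>V \<times> V. g y * (u (fst y) * v (snd y))) \<le> \<epsilon> * (real (card V))\<^sup>2"
      using h by (intro bilinear_le_of_cut_le fin cut) (auto simp: u_def v_def intro!: prod_nonneg prod_le_1)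
    then show "(\<Sum>y\<in>V \<times> V. g (map_prod (z(a := fst y, b := snd y)) (z(a := fst y, b := snd y)) e0) *
         (\<Prod>e\<in>D - {e0}. h e (map_prod (z(a := fst y, b := snd y)) (z(a := fst y, b := snd y)) e)))
        \<le> \<epsilon> * (real (card V))\<^sup>2"
      unfolding split using ab by (simp add: e0_eq)
  qed
qed

text \<open>Hybrid argument: \<open>d\<close> is replaced by \<open>f\<close> on one pair at a time,
  \<open>X\<close> being the pairs already replaced. Each replacement changes the product by (d - f)
  times factors in [0, 1], which costs at most \<epsilon> |V|^|I| by
  \<open>hom_sum_swap_le\<close>.\<close>

lemma counting_lemma:
  fixes f d :: "'i \<times> 'i \<Rightarrow> 'a \<times> 'a \<Rightarrow> real"
  assumes fin: "finite V" "finite I"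
    and D: "\<And>e. e \<in> D \<Longrightarrow> fst e \<in> I \<and> snd e \<in> I \<and> fst e \<noteq> snd e"
    and asym: "\<And>a b. (a, b) \<in> D \<Longrightarrow> (b, a) \<notin> D"
    and f: "\<And>e z. 0 \<le> f e z \<and> f e z \<le> 1" and d: "\<And>e z. 0 \<le> d e z \<and> d e z \<le> 1"
    and cut: "\<And>e U W. e \<in> D \<Longrightarrow> U \<subseteq> V \<Longrightarrow> W \<subseteq> V \<Longrightarrow>
      (\<Sum>z\<in>U \<times> W. d e z - f e z) \<le> \<epsilon> * (real (card V))\<^sup>2"
  shows "(\<Sum>x\<in>I \<rightarrow>\<^sub>E V. \<Prod>e\<in>D. d e (map_prod x x e))
    \<le> (\<Sum>x\<in>I \<rightarrow>\<^sub>E V. \<Prod>e\<in>D. f e (map_prod x x e)) + real (card D) * \<epsilon> * real (card V) ^ card I"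
proof -
  have finD: "finite D"
    by (rule finite_subset[of _ "I \<times> I"]) (use D fin in \<open>auto simp: mem_Times_iff\<close>)
  define h where "h X e = (if e \<in> X then f e else d e)" for X e
  have h01: "0 \<le> h X e z \<and> h X e z \<le> 1" for X e z
    using f d by (auto simp: h_def)
  have "(\<Sum>x\<in>I \<rightarrow>\<^sub>E V. \<Prod>e\<in>D. d e (map_prod x x e))
      \<le> (\<Sum>x\<in>I \<rightarrow>\<^sub>E V. \<Prod>e\<in>D. h X e (map_prod x x e)) + real (card X) * \<epsilon> * real (card V) ^ card I"
    if "X \<subseteq> D" for X
    using finite_subset[OF that finD] that
  proof (induction rule: finite_subset_induct)
    case empty
    show ?case by (simp add: h_def)
  next
    case (insert e0 X)
    have rest: "(\<Prod>e\<in>D - {e0}. h (insert e0 X) e (map_prod x x e)) = (\<Prod>e\<in>D - {e0}. h X e (map_prod x x e))" for x :: "'i \<Rightarrow> 'a"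
      by (rule prod.cong) (auto simp: h_def)
    have "(\<Prod>e\<in>D. h X e (map_prod x x e)) - (\<Prod>e\<in>D. h (insert e0 X) e (map_prod x x e))
        = (d e0 (map_prod x x e0) - f e0 (map_prod x x e0)) * (\<Prod>e\<in>D - {e0}. h X e (map_prod x x e))" for x :: "'i \<Rightarrow> 'a"
      using insert.hyps finD
      by (simp add: prod.remove[OF finD \<open>e0 \<in> D\<close>] rest algebra_simps) (simp add: h_def)
    then have "(\<Sum>x\<in>I \<rightarrow>\<^sub>E V. \<Prod>e\<in>D. h X e (map_prod x x e)) - (\<Sum>x\<in>I \<rightarrow>\<^sub>E V. \<Prod>e\<in>D. h (insert e0 X) e (map_prod x x e))
      = (\<Sum>x\<in>I \<rightarrow>\<^sub>E V. (d e0 (map_prod x x e0) - f e0 (map_prod x x e0)) * (\<Prod>e\<in>D - {e0}. h X e (map_prod x x e)))"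
      by (simp add: sum_subtractf[symmetric])
    also have "\<dots> \<le> \<epsilon> * real (card V) ^ card I"
      using insert.hyps cut
      by (intro hom_sum_swap_le[where g = "\<lambda>z. d e0 z - f e0 z"] fin D asym h01) auto
    finally show ?case
      using insert by (simp add: algebra_simps)
  qed
  from this[of D] show ?thesis
    by (simp add: h_def)
qed

section \<open>Templates from regular partitions\<close>

text \<open>Edges oriented upwards. Densities live on ordered pairs of cells and may differ in the
  two directions, so an unordered edge would not determine one.\<close>

definition pairs :: "nat \<Rightarrow> (nat \<times> nat) set" where
  "pairs n = {(a, b). a \<in> {1..n} \<and> b \<in> {1..n} \<and> a < b}"

abbreviation edge_of :: "nat \<times> nat \<Rightarrow> edge" where
  "edge_of e \<equiv> {fst e, snd e}"

lemma finite_pairs: "finite (pairs n)"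
  by (rule finite_subset[of _ "{1..n} \<times> {1..n}"]) (auto simp: pairs_def)

lemma finite_K_edges [simp]: "finite (K_edges n)"
  by (rule finite_subset[of _ "Pow {1..n}"]) (auto simp: K_edges_def)

lemma card_K_edges: "card (K_edges n) = n choose 2"
  using n_subsets[of "{1..n}" 2] by (simp add: K_edges_def)

lemma K_edges_eq_image: "K_edges n = edge_of ` pairs n"
proof -
  have "e \<in> edge_of ` pairs n" if e: "e \<subseteq> {1..n}" "card e = 2" for e
  proof -
    obtain x y where xy: "e = {x, y}" "x \<noteq> y"
      using e(2) by (auto simp: card_2_iff)
    show ?thesis
    proof (cases "x < y")
      case True
      then show ?thesis using e xy by (intro image_eqI[of _ _ "(x, y)"]) (auto simp: pairs_def)
    next
      case False
      then show ?thesis using e xy by (intro image_eqI[of _ _ "(y, x)"]) (auto simp: pairs_def)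
    qed
  qed
  then show ?thesis by (auto simp: K_edges_def pairs_def)
qed

lemma edge_of_in_K_edges: "e \<in> pairs n \<Longrightarrow> edge_of e \<in> K_edges n"
  by (auto simp: K_edges_eq_image)

lemma finite_colourings [simp]: "finite (colourings k n)"
  by (auto simp: colourings_def intro!: finite_PiE)

lemma finite_templates [simp]: "finite (templates k n)"
  by (auto simp: templates_def intro!: finite_PiE)

lemma map_prod_order_injection_in_pairs:
  assumes "\<phi> \<in> order_injections m n" "e \<in> pairs m"
  shows "map_prod \<phi> \<phi> e \<in> pairs n"
proof -
  obtain a b where e: "e = (a, b)" by (cases e)
  have ab: "a \<in> {1..m}" "b \<in> {1..m}" "a < b"
    using assms(2) by (auto simp: e pairs_def)
  have \<phi>: "\<phi> \<in> {1..m} \<rightarrow>\<^sub>E {1..n}" "inj_on \<phi> {1..m}" "mono_on {1..m} \<phi>"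
    using assms(1) by (auto simp: order_injections_def)
  have "\<phi> a \<le> \<phi> b"
    using mono_onD[OF \<phi>(3) ab(1,2)] ab(3) by simp
  moreover have "\<phi> a \<noteq> \<phi> b"
    using inj_onD[OF \<phi>(2) _ ab(1,2)] ab(3) by blast
  ultimately show ?thesis
    using PiE_mem[OF \<phi>(1) ab(1)] PiE_mem[OF \<phi>(1) ab(2)] by (simp add: e pairs_def)
qed

text \<open>\<open>f q\<close> is the ordered indicator of colour \<open>q\<close>, \<open>d q\<close> its cell density, and \<open>B\<close> the set of pairs whose
  own colour is sparse. Only pairs in \<open>B\<close> can have no dense colour at all; nothing is assumed about \<open>t\<close>
  there.\<close>

context
  fixes k n :: nat and P :: "nat \<Rightarrow> colouring set" and c :: colouring
    and p :: "nat \<Rightarrow> nat" and \<epsilon> \<eta> :: real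
    and f d :: "nat \<Rightarrow> nat \<times> nat \<Rightarrow> real" and B :: "(nat \<times> nat) set" and t :: template
  assumes hereditary: "order_hereditary k P" and c: "c \<in> P n"
    and \<eta>: "0 < \<eta>" and "0 \<le> \<epsilon>"
    and f_def: "\<And>q z. f q z = of_bool (fst z < snd z \<and> c (edge_of z) = q)"
    and d_def: "\<And>q. d q = cell_avg ({1..n} \<times> {1..n}) (map_prod p p) (f q)"
    and regular: "\<And>q U W. q \<in> {1..k} \<Longrightarrow> U \<subseteq> {1..n} \<Longrightarrow> W \<subseteq> {1..n} \<Longrightarrow>
      (\<Sum>z\<in>U \<times> W. d q z - f q z) \<le> \<epsilon> * (real n)\<^sup>2"
    and B_def: "B = {z \<in> pairs n. d (c (edge_of z)) z < \<eta>}"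
    and t: "\<And>z. z \<in> pairs n \<Longrightarrow> {q\<in>{1..k}. d q z \<ge> \<eta>} \<noteq> {} \<Longrightarrow>
      t (edge_of z) = {q\<in>{1..k}. d q z \<ge> \<eta>}"
begin

lemma colour_range:
  assumes "z \<in> pairs n"
  shows "c (edge_of z) \<in> {1..k}"
proof -
  have "c \<in> K_edges n \<rightarrow>\<^sub>E {1..k}"
    using hereditary c unfolding order_hereditary_def colourings_def by blast
  then show ?thesis
    using edge_of_in_K_edges[OF assms] by (rule PiE_mem)
qed

lemma density_bounds: "0 \<le> d q z \<and> d q z \<le> 1"
  unfolding d_def by (intro conjI cell_avg_bounds) (auto simp: f_def)

text \<open>For a fixed colour, being sparse depends only on the cell, so by the projection property
  the pairs of that colour in its sparse cells number the same as the sum of the densities over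
  these cells, at most \<eta> n^2. Every pair of \<open>B\<close> is counted at its own colour,
  whence the factor \<open>k\<close>.\<close>

lemma card_sparse_pairs: "real (card B) \<le> real k * \<eta> * (real n)\<^sup>2"
proof -
  let ?A = "{1..n} \<times> {1..n}"
  have fin: "finite ?A" by simp
  define C where "C q = {z\<in>B. c (edge_of z) = q}" for q
  have "real (card (C q)) \<le> \<eta> * (real n)\<^sup>2" for q
  proof -
    obtain g where g: "\<And>z. d q z = g (map_prod p p z)"
      using cell_avg_factor[of ?A "map_prod p p" "f q"] unfolding d_def by blast
    let ?h = "\<lambda>l. of_bool (g l < \<eta>) :: real"
    have "real (card (C q)) = (\<Sum>z\<in>C q. 1)" by simp
    also have "\<dots> \<le> (\<Sum>z\<in>C q. f q z * ?h (map_prod p p z))"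
      by (intro sum_mono) (auto simp: C_def B_def f_def pairs_def simp flip: g)
    also have "\<dots> \<le> (\<Sum>z\<in>?A. f q z * ?h (map_prod p p z))"
      by (intro sum_mono2) (auto simp: C_def B_def f_def pairs_def)
    also have "\<dots> = (\<Sum>z\<in>?A. d q z * ?h (map_prod p p z))"
      unfolding d_def using sum_cell_avg_mult[OF fin, of "map_prod p p" "f q" ?h] by simp
    also have "\<dots> \<le> (\<Sum>z\<in>?A. \<eta>)"
      unfolding g using \<eta> by (intro sum_mono) auto
    also have "\<dots> = \<eta> * (real n)\<^sup>2"
      by (simp add: power2_eq_square)
    finally show ?thesis .
  qed
  then have "(\<Sum>q\<in>{1..k}. real (card (C q))) \<le> (\<Sum>q\<in>{1..k}. \<eta> * (real n)\<^sup>2)"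
    by (intro sum_mono)
  moreover have "card B \<le> (\<Sum>q\<in>{1..k}. card (C q))"
  proof -
    have "B \<subseteq> (\<Union>q\<in>{1..k}. C q)"
      using colour_range by (auto simp: C_def B_def)
    moreover have "finite (\<Union>q\<in>{1..k}. C q)"
      using finite_pairs by (auto simp: C_def B_def)
    ultimately have "card B \<le> card (\<Union>q\<in>{1..k}. C q)"
      by (rule card_mono[rotated])
    also have "\<dots> \<le> (\<Sum>q\<in>{1..k}. card (C q))"
      by (rule card_UN_le) simp
    finally show ?thesis .
  qed
  then have "real (card B) \<le> (\<Sum>q\<in>{1..k}. real (card (C q)))"
    by (metis of_nat_le_iff of_nat_sum)
  ultimately show ?thesis by simp
qed

lemma finite_B: "finite B"
  using finite_pairs by (simp add: B_def)

lemma dense_palette: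
  assumes "z \<in> pairs n" "z \<notin> B"
  shows "t (edge_of z) = {q\<in>{1..k}. d q z \<ge> \<eta>}" "c (edge_of z) \<in> t (edge_of z)"
proof -
  have *: "c (edge_of z) \<in> {q\<in>{1..k}. d q z \<ge> \<eta>}"
    using assms colour_range by (auto simp: B_def)
  then show "t (edge_of z) = {q\<in>{1..k}. d q z \<ge> \<eta>}"
    using assms(1) t by blast
  with * show "c (edge_of z) \<in> t (edge_of z)" by simp
qed

lemma card_mismatches: "real (card {e \<in> K_edges n. c e \<notin> t e}) \<le> real k * \<eta> * (real n)\<^sup>2"
proof -
  have "{e \<in> K_edges n. c e \<notin> t e} \<subseteq> edge_of ` B"
    using dense_palette(2) by (auto simp: K_edges_eq_image)
  then have "card {e \<in> K_edges n. c e \<notin> t e} \<le> card B"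
    using finite_B surj_card_le by blast
  then show ?thesis
    using card_sparse_pairs by linarith
qed

text \<open>Since \<open>f\<close> vanishes unless its arguments are increasing, a nonzero product makes \<open>x\<close> an order
  injection along which \<open>c\<close> restricts to \<open>\<psi>\<close>.\<close>

lemma forbidden_hom_count_zero:
  assumes "\<psi> \<in> colourings k m" "\<psi> \<notin> P m" "x \<in> {1..m} \<rightarrow>\<^sub>E {1..n}"
  shows "(\<Prod>e\<in>pairs m. f (\<psi> (edge_of e)) (map_prod x x e)) = 0"
proof (rule ccontr)
  assume "\<not> ?thesis"
  then have ne: "f (\<psi> (edge_of e)) (map_prod x x e) \<noteq> 0" if "e \<in> pairs m" for e
    using that finite_pairs by (auto simp: prod_zero_iff)
  have lt: "x a < x b" if "a \<in> {1..m}" "b \<in> {1..m}" "a < b" for a b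
    using ne[of "(a, b)"] that by (auto simp: f_def pairs_def)
  have "inj_on x {1..m}"
    by (rule linorder_inj_onI) (use lt in force)+
  moreover have "mono_on {1..m} x"
    using lt by (intro mono_onI) (metis order.order_iff_strict)
  ultimately have "x \<in> order_injections m n"
    using assms(3) by (simp add: order_injections_def)
  then have "pullback m x c \<in> P m"
    using hereditary c unfolding order_hereditary_def by blast
  moreover have "pullback m x c = \<psi>"
  proof
    fix e
    show "pullback m x c e = \<psi> e"
    proof (cases "e \<in> K_edges m")
      case True
      then obtain z where z: "z \<in> pairs m" "e = edge_of z"
        by (auto simp: K_edges_eq_image)
      then show ?thesis
        using ne[OF z(1)] True by (simp add: f_def pullback_def)
    next
      case False
      then show ?thesis
        using assms(1) by (auto simp: pullback_def colourings_def PiE_def extensional_def)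
    qed
  qed
  ultimately show False
    using assms(2) by simp
qed

text \<open>Each counted map contributes at least \<eta>^(m choose 2) to the density-weighted count.
  The corresponding count with \<open>f\<close> is 0 for a forbidden \<psi>, so only the error term
  of the counting lemma remains.\<close>

lemma card_dense_forbidden:
  assumes \<psi>: "\<psi> \<in> colourings k m" "\<psi> \<notin> P m"
  shows "real (card {x \<in> {1..m} \<rightarrow>\<^sub>E {1..n}. \<forall>e\<in>pairs m. d (\<psi> (edge_of e)) (map_prod x x e) \<ge> \<eta>})
    \<le> real (card (pairs m)) * \<epsilon> * real n ^ m / \<eta> ^ card (pairs m)" (is "real (card ?X) \<le> _")
proof -
  have \<psi>k: "\<psi> (edge_of e) \<in> {1..k}" if "e \<in> pairs m" for e
    using \<psi>(1) edge_of_in_K_edges[OF that] by (auto simp: colourings_def)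
  have fin: "finite ({1..m} \<rightarrow>\<^sub>E {1..n})"
    by (intro finite_PiE) auto
  have "real (card ?X) * \<eta> ^ card (pairs m) = (\<Sum>x\<in>?X. \<Prod>e\<in>pairs m. \<eta>)"
    by simp
  also have "\<dots> \<le> (\<Sum>x\<in>?X. \<Prod>e\<in>pairs m. d (\<psi> (edge_of e)) (map_prod x x e))"
    using \<eta> by (intro sum_mono prod_mono) auto
  also have "\<dots> \<le> (\<Sum>x\<in>{1..m} \<rightarrow>\<^sub>E {1..n}. \<Prod>e\<in>pairs m. d (\<psi> (edge_of e)) (map_prod x x e))"
    using density_bounds fin by (intro sum_mono2 prod_nonneg) auto
  also have "\<dots> \<le> (\<Sum>x\<in>{1..m} \<rightarrow>\<^sub>E {1..n}. \<Prod>e\<in>pairs m. f (\<psi> (edge_of e)) (map_prod x x e))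
      + real (card (pairs m)) * \<epsilon> * real (card {1..n}) ^ card {1..m}"
    by (rule counting_lemma)
       (use density_bounds regular \<psi>k in \<open>auto simp: pairs_def f_def\<close>)
  also have "(\<Sum>x\<in>{1..m} \<rightarrow>\<^sub>E {1..n}. \<Prod>e\<in>pairs m. f (\<psi> (edge_of e)) (map_prod x x e)) = 0"
    using forbidden_hom_count_zero[OF \<psi>] by simp
  finally show ?thesis
    using \<eta> by (simp add: pos_le_divide_eq)
qed

text \<open>Union bound over the pairs \<open>e\<close>: with the other m - 2 coordinates fixed, the
  two at \<open>e\<close> can be placed in \<open>B\<close> in |B| ways.\<close>

lemma card_through_sparse:
  "real (card {x \<in> {1..m} \<rightarrow>\<^sub>E {1..n}. \<exists>e\<in>pairs m. map_prod x x e \<in> B})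
    \<le> real (card (pairs m)) * (real k * \<eta>) * real n ^ m" (is "real (card ?X) \<le> _")
proof -
  have fin: "finite ({1..m} \<rightarrow>\<^sub>E {1..n})"
    by (intro finite_PiE) auto
  have one: "(\<Sum>x\<in>{1..m} \<rightarrow>\<^sub>E {1..n}. of_bool (map_prod x x e \<in> B)) \<le> (real k * \<eta>) * real n ^ m"
    if e: "e \<in> pairs m" for e
  proof -
    obtain a b where ab: "e = (a, b)" "a \<in> {1..m}" "b \<in> {1..m}" "a \<noteq> b"
      using e by (cases e) (auto simp: pairs_def)
    have BA: "B \<subseteq> {1..n} \<times> {1..n}"
      by (auto simp: B_def pairs_def)
    have "(\<Sum>x\<in>{1..m} \<rightarrow>\<^sub>E {1..n}. of_bool (map_prod x x e \<in> B)) \<le> (real k * \<eta>) * real (card {1..n}) ^ card {1..m}"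
    proof (rule sum_PiE_resample_le[OF _ _ ab(2-4)])
      fix z :: "nat \<Rightarrow> nat"
      have "(\<Sum>y\<in>{1..n} \<times> {1..n}. of_bool (map_prod (z(a := fst y, b := snd y)) (z(a := fst y, b := snd y)) e \<in> B))
          = (\<Sum>y\<in>{1..n} \<times> {1..n}. of_bool (y \<in> B) :: real)"
        using ab by (intro sum.cong) auto
      also have "\<dots> = real (card B)"
        using BA by (simp add: Int_absorb1)
      finally show "(\<Sum>y\<in>{1..n} \<times> {1..n}. of_bool (map_prod (z(a := fst y, b := snd y)) (z(a := fst y, b := snd y)) e \<in> B))
          \<le> real k * \<eta> * (real (card {1..n}))\<^sup>2"
        using card_sparse_pairs by simp
    qed auto
    then show ?thesis by simp
  qed
  have "real (card ?X) = (\<Sum>x\<in>?X. 1)" by simp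
  also have "\<dots> \<le> (\<Sum>x\<in>?X. \<Sum>e\<in>pairs m. of_bool (map_prod x x e \<in> B))"
  proof (rule sum_mono)
    fix x assume "x \<in> ?X"
    then obtain e where "e \<in> pairs m" "map_prod x x e \<in> B" by blast
    then show "1 \<le> (\<Sum>e\<in>pairs m. of_bool (map_prod x x e \<in> B) :: real)"
      using member_le_sum[of e "pairs m" "\<lambda>e. of_bool (map_prod x x e \<in> B) :: real"] finite_pairs by auto
  qed
  also have "\<dots> \<le> (\<Sum>x\<in>{1..m} \<rightarrow>\<^sub>E {1..n}. \<Sum>e\<in>pairs m. of_bool (map_prod x x e \<in> B))"
    using fin by (intro sum_mono2 sum_nonneg) auto
  also have "\<dots> = (\<Sum>e\<in>pairs m. \<Sum>x\<in>{1..m} \<rightarrow>\<^sub>E {1..n}. of_bool (map_prod x x e \<in> B))"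
    by (rule sum.swap)
  also have "\<dots> \<le> (\<Sum>e\<in>pairs m. (real k * \<eta>) * real n ^ m)"
    by (intro sum_mono one)
  finally show ?thesis by simp
qed

text \<open>Off \<open>B\<close> the palette is exactly the set of dense colours. Hence a forbidden
  \<psi> realised along \<phi> either uses dense colours on all pairs, or some pair is sent into
  \<open>B\<close>; the two preceding bounds cover these cases.\<close>

lemma card_bad_pairs_le:
  "real (card (bad_pairs k P m n t))
    \<le> real (card (colourings k m)) * real (card (pairs m)) * (real k * \<eta> + \<epsilon> / \<eta> ^ card (pairs m)) * real n ^ m"
proof -
  define X where "X = {x \<in> {1..m} \<rightarrow>\<^sub>E {1..n}. \<exists>e\<in>pairs m. map_prod x x e \<in> B}"
  define Y where "Y \<psi> = {x \<in> {1..m} \<rightarrow>\<^sub>E {1..n}. \<forall>e\<in>pairs m. d (\<psi> (edge_of e)) (map_prod x x e) \<ge> \<eta>}" for \<psi>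
  let ?C = "{\<psi> \<in> colourings k m. \<psi> \<notin> P m}"
  have fin: "finite ({1..m} \<rightarrow>\<^sub>E {1..n})"
    by (intro finite_PiE) auto
  have "bad_pairs k P m n t \<subseteq> (\<Union>\<psi>\<in>?C. (X \<union> Y \<psi>) \<times> {\<psi>})"
  proof (clarsimp simp: bad_pairs_def)
    fix \<phi> \<psi>
    assume \<phi>: "\<phi> \<in> order_injections m n" and \<psi>: "\<psi> \<in> realisations k m (pullback m \<phi> t)"
      and "\<phi> \<notin> Y \<psi>"
    have \<phi>F: "\<phi> \<in> {1..m} \<rightarrow>\<^sub>E {1..n}"
      using \<phi> by (simp add: order_injections_def)
    then obtain e where e: "e \<in> pairs m" "\<not> d (\<psi> (edge_of e)) (map_prod \<phi> \<phi> e) \<ge> \<eta>"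
      using \<open>\<phi> \<notin> Y \<psi>\<close> by (auto simp: Y_def)
    have "\<psi> (edge_of e) \<in> t (edge_of (map_prod \<phi> \<phi> e))"
      using \<psi> edge_of_in_K_edges[OF e(1)] by (auto simp: realisations_def pullback_def)
    then have "map_prod \<phi> \<phi> e \<in> B"
      using dense_palette(1)[of "map_prod \<phi> \<phi> e"] map_prod_order_injection_in_pairs[OF \<phi> e(1)] e(2) by blast
    then show "\<phi> \<in> X"
      using e(1) \<phi>F by (auto simp: X_def)
  qed
  moreover have "finite (\<Union>\<psi>\<in>?C. (X \<union> Y \<psi>) \<times> {\<psi>})"
    using fin by (auto simp: X_def Y_def)
  ultimately have "card (bad_pairs k P m n t) \<le> card (\<Union>\<psi>\<in>?C. (X \<union> Y \<psi>) \<times> {\<psi>})"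
    by (rule card_mono[rotated])
  also have "\<dots> \<le> (\<Sum>\<psi>\<in>?C. card ((X \<union> Y \<psi>) \<times> {\<psi>}))"
    by (rule card_UN_le) simp
  also have "\<dots> \<le> (\<Sum>\<psi>\<in>?C. card X + card (Y \<psi>))"
    by (intro sum_mono) (simp add: card_cartesian_product card_Un_le)
  finally have "real (card (bad_pairs k P m n t)) \<le> (\<Sum>\<psi>\<in>?C. real (card X) + real (card (Y \<psi>)))"
    by (simp flip: of_nat_add of_nat_sum)
  also have "\<dots> \<le> (\<Sum>\<psi>\<in>?C. real (card (pairs m)) * (real k * \<eta>) * real n ^ m
      + real (card (pairs m)) * \<epsilon> * real n ^ m / \<eta> ^ card (pairs m))"
    unfolding X_def Y_def
    by (intro sum_mono add_mono card_through_sparse card_dense_forbidden) auto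
  also have "\<dots> = real (card ?C) * (real (card (pairs m)) * (real k * \<eta> + \<epsilon> / \<eta> ^ card (pairs m)) * real n ^ m)"
    by (simp add: algebra_simps)
  also have "\<dots> \<le> real (card (colourings k m)) * (real (card (pairs m)) * (real k * \<eta> + \<epsilon> / \<eta> ^ card (pairs m)) * real n ^ m)"
  proof (rule mult_right_mono)
    show "real (card ?C) \<le> real (card (colourings k m))"
      by (intro of_nat_mono card_mono) auto
    show "0 \<le> real (card (pairs m)) * (real k * \<eta> + \<epsilon> / \<eta> ^ card (pairs m)) * real n ^ m"
      using \<eta> \<open>0 \<le> \<epsilon>\<close> by simp
  qed
  finally show ?thesis by (simp add: mult.assoc)
qed

end

section \<open>Step templates and the container theorem\<close>

text \<open>A template determined by a vertex labelling and a palette for each ordered pair of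
  labels, so that few exist. \<open>Min\<close> and \<open>Max\<close> recover the orientation of
  the edge; the default \<open>{1}\<close> keeps the palette nonempty where no colour is
  dense.\<close>

definition step_template :: "nat \<Rightarrow> (nat \<Rightarrow> nat) \<Rightarrow> (nat \<times> nat \<Rightarrow> nat set) \<Rightarrow> template" where
  "step_template n p \<tau> = (\<lambda>e\<in>K_edges n.
     let Q = \<tau> (p (Min e), p (Max e)) in if Q = {} then {1} else Q)"

lemma step_template_edge_of:
  assumes "z \<in> pairs n"
  shows "step_template n p \<tau> (edge_of z) =
    (let Q = \<tau> (map_prod p p z) in if Q = {} then {1} else Q)"
proof -
  obtain x y where z: "z = (x, y)" "x < y"
    using assms by (cases z) (auto simp: pairs_def)
  then have "Min {x, y} = x" "Max {x, y} = y"
    by (auto simp: min_def max_def)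
  then show ?thesis
    using edge_of_in_K_edges[OF assms] by (simp add: step_template_def z)
qed

lemma step_template_in_templates:
  assumes "1 \<le> k" and "\<And>x. x \<in> {1..n} \<Longrightarrow> p x \<in> R" and "\<tau> \<in> R \<times> R \<rightarrow> Pow {1..k}"
  shows "step_template n p \<tau> \<in> templates k n"
  unfolding templates_def
proof (rule PiE_I)
  fix e assume "e \<in> K_edges n"
  then obtain z where z: "z \<in> pairs n" "e = edge_of z"
    by (auto simp: K_edges_eq_image)
  then have "map_prod p p z \<in> R \<times> R"
    using assms(2) by (auto simp: pairs_def)
  then have "\<tau> (map_prod p p z) \<in> Pow {1..k}"
    by (rule funcset_mem[OF assms(3)])
  then show "step_template n p \<tau> e \<in> Pow {1..k} - {{}}"
    using step_template_edge_of[OF z(1)] z(2) assms(1) by (auto simp: Let_def)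
qed (simp add: step_template_def)

lemma power_le_binomial:
  assumes "m \<le> n"
  shows "real n ^ m \<le> real m ^ m * real (n choose m)"
proof (cases "m = 0")
  case False
  have "(real n / real m) ^ m \<le> real (n choose m)"
    by (rule binomial_ge_n_over_k_pow_k[OF assms])
  then show ?thesis
    using False by (simp add: power_divide divide_le_eq mult.commute)
qed simp

lemma square_le_binomial:
  assumes "2 \<le> n"
  shows "(real n)\<^sup>2 \<le> 4 * real (n choose 2)"
  using power_le_binomial[OF assms] by simp

text \<open>The template built from a colouring depends on it only through the labelling and the
  palette matrix: at most R^n labellings and (2^k)^(R^2) matrices.\<close>

lemma container_theorem:
  assumes hereditary: "order_hereditary k P" and k: "1 \<le> k" and "0 < \<delta>" "0 < \<gamma>"
  shows "\<exists>R. \<forall>n\<ge>max m 2. \<exists>F \<subseteq> templates k n. card F \<le> R ^ n * 2 ^ (k * (R * R)) \<and>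
    (\<forall>c\<in>P n. \<exists>t\<in>F. real (card {e \<in> K_edges n. c e \<notin> t e}) \<le> \<gamma> * real (n choose 2) \<and>
      real (card (bad_pairs k P m n t)) \<le> \<delta> * real (n choose m))"
proof -
  define K where "K = real (card (colourings k m)) * real (card (pairs m))"
  define M where "M = real m ^ m"
  let ?D = "card (pairs m)"
  have K0: "0 \<le> K" "0 \<le> M"
    by (simp_all add: K_def M_def)
  \<comment> \<open>The first bound turns k \<eta> n^2 mismatches into \<gamma> (n choose 2), the 4
    coming from n^2 <= 4 (n choose 2). The second lets maps through sparse pairs use at most half of
    \<delta> (n choose m); the \<open>+ 1\<close> guards against \<open>K = 0\<close>.\<close>
  define \<eta> where "\<eta> = min (\<gamma> / (4 * real k)) (\<delta> / (2 * (K * real k * M + 1)))"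
  have den: "0 < 2 * (K * real k * M + 1)"
    using K0 by (simp add: add_nonneg_pos)
  have \<eta>0: "0 < \<eta>"
    using den k \<open>0 < \<delta>\<close> \<open>0 < \<gamma>\<close> by (auto simp: \<eta>_def)
  have "\<eta> \<le> \<gamma> / (4 * real k)"
    by (simp add: \<eta>_def)
  then have \<eta>1: "real k * \<eta> * 4 \<le> \<gamma>"
    using k by (simp add: field_simps)
  have "\<eta> \<le> \<delta> / (2 * (K * real k * M + 1))"
    by (simp add: \<eta>_def)
  then have "\<eta> * (2 * (K * real k * M + 1)) \<le> \<delta>"
    using den by (simp add: pos_le_divide_eq)
  then have \<eta>2: "K * (real k * \<eta>) * M \<le> \<delta> / 2"
    using \<eta>0 by (simp add: algebra_simps)
  \<comment> \<open>Chosen after \<eta> because the copies with dense colours are bounded by a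
    multiple of \<epsilon> / \<eta>^D; they get the other half of \<delta>.\<close>
  define \<epsilon> where "\<epsilon> = \<delta> / 2 * \<eta> ^ ?D / (K * M + 1)"
  have den': "0 < K * M + 1"
    using K0 by (simp add: add_nonneg_pos)
  have \<epsilon>0: "0 < \<epsilon>"
    using den' \<eta>0 \<open>0 < \<delta>\<close> by (simp add: \<epsilon>_def)
  have "\<epsilon> / \<eta> ^ ?D * (K * M + 1) = \<delta> / 2"
    using den' \<eta>0 unfolding \<epsilon>_def by (simp del: distrib_left_numeral distrib_right_numeral)
  moreover have "0 < \<epsilon> / \<eta> ^ ?D"
    using \<epsilon>0 \<eta>0 by simp
  moreover have "K * w * M = w * (K * M + 1) - w" for w
    by (simp add: algebra_simps)
  ultimately have \<epsilon>1: "K * (\<epsilon> / \<eta> ^ ?D) * M \<le> \<delta> / 2"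
    by (metis diff_le_eq le_add_same_cancel1 less_imp_le)
  \<comment> \<open>One function per colour, so the energy is at most k n^2. \<open>T\<close>, and
    with it \<open>R\<close>, depends on k, m, \<gamma> and \<delta> but not on n.\<close>
  obtain T :: nat where T: "real k < real T * \<epsilon>\<^sup>2"
    using reals_Archimedean3[of "\<epsilon>\<^sup>2"] \<epsilon>0 by auto
  define R where "R = (4::nat) ^ T"
  have "\<exists>F \<subseteq> templates k n. card F \<le> R ^ n * 2 ^ (k * (R * R)) \<and>
    (\<forall>c\<in>P n. \<exists>t\<in>F. real (card {e \<in> K_edges n. c e \<notin> t e}) \<le> \<gamma> * real (n choose 2) \<and>
      real (card (bad_pairs k P m n t)) \<le> \<delta> * real (n choose m))" if n: "n \<ge> max m 2" for n
  proof -
    define X where "X = ({1..n} \<rightarrow>\<^sub>E {..<R}) \<times> (({..<R} \<times> {..<R}) \<rightarrow>\<^sub>E Pow {1..k})"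
    define F where "F = (\<lambda>(p, \<tau>). step_template n p \<tau>) ` X"
    have finX: "finite X"
      unfolding X_def by (intro finite_cartesian_product finite_PiE) auto
    have "card F \<le> card X"
      unfolding F_def by (rule card_image_le[OF finX])
    also have "card X = R ^ n * 2 ^ (k * (R * R))"
      by (simp add: X_def card_cartesian_product card_PiE card_Pow power_mult)
    finally have cardF: "card F \<le> R ^ n * 2 ^ (k * (R * R))" .
    have "step_template n p \<tau> \<in> templates k n" if "(p, \<tau>) \<in> X" for p \<tau>
      using that by (intro step_template_in_templates[OF k, of _ _ "{..<R}"]) (auto simp: X_def PiE_def)
    then have F: "F \<subseteq> templates k n"
      by (auto simp: F_def)
    have "\<exists>t\<in>F. real (card {e \<in> K_edges n. c e \<notin> t e}) \<le> \<gamma> * real (n choose 2) \<and>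
      real (card (bad_pairs k P m n t)) \<le> \<delta> * real (n choose m)" if c: "c \<in> P n" for c
    proof -
      define f :: "nat \<Rightarrow> nat \<times> nat \<Rightarrow> real"
        where "f q z = of_bool (fst z < snd z \<and> c (edge_of z) = q)" for q z
      have V: "finite {1..n}" "{1..n} \<noteq> {}"
        using n by auto
      have f01: "0 \<le> f q z \<and> f q z \<le> 1" for q z
        by (simp add: f_def)
      have cards: "real (card {1..k}) < real T * \<epsilon>\<^sup>2" "real (card {1..n}) = real n"
        using T by simp_all
      obtain p where p: "(\<forall>x. p x < R) \<and> (\<forall>q\<in>{1..k}. \<forall>U W. U \<subseteq> {1..n} \<longrightarrow> W \<subseteq> {1..n} \<longrightarrow>
          (\<Sum>z\<in>U \<times> W. cell_avg ({1..n} \<times> {1..n}) (map_prod p p) (f q) z - f q z) \<le> \<epsilon> * (real n)\<^sup>2)"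
        using weak_regularity[OF V finite_atLeastAtMost less_imp_le[OF \<epsilon>0] cards(1), of f, OF f01]
        unfolding cards(2) R_def by (rule exE)
      then have pR: "p x < R" for x
        by simp
      have reg: "(\<Sum>z\<in>U \<times> W. cell_avg ({1..n} \<times> {1..n}) (map_prod p p) (f q) z - f q z) \<le> \<epsilon> * (real n)\<^sup>2"
        if "q \<in> {1..k}" "U \<subseteq> {1..n}" "W \<subseteq> {1..n}" for q U W
        using p[THEN conjunct2] that by simp
      define d where "d q = cell_avg ({1..n} \<times> {1..n}) (map_prod p p) (f q)" for q
      have "\<forall>q. \<exists>g. \<forall>z. d q z = g (map_prod p p z)"
        unfolding d_def by (intro allI cell_avg_factor)
      then obtain g where g: "\<And>q z. d q z = g q (map_prod p p z)"
        by metis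
      define \<tau> where "\<tau> = (\<lambda>l\<in>{..<R} \<times> {..<R}. {q\<in>{1..k}. g q l \<ge> \<eta>})"
      \<comment> \<open>Restricting \<open>p\<close> makes it extensional, so that it is one of the
        finitely many labellings counted in \<open>X\<close>.\<close>
      define t where "t = step_template n (restrict p {1..n}) \<tau>"
      have "(restrict p {1..n}, \<tau>) \<in> X"
        using pR by (auto simp: X_def \<tau>_def)
      then have tF: "t \<in> F"
        by (force simp: F_def t_def)
      have t: "t (edge_of z) = {q\<in>{1..k}. d q z \<ge> \<eta>}"
        if z: "z \<in> pairs n" and ne: "{q\<in>{1..k}. d q z \<ge> \<eta>} \<noteq> {}" for z
      proof -
        have "map_prod (restrict p {1..n}) (restrict p {1..n}) z = map_prod p p z"
          using z by (auto simp: pairs_def)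
        moreover have "map_prod p p z \<in> {..<R} \<times> {..<R}"
          using pR by (cases z) auto
        ultimately have "\<tau> (map_prod (restrict p {1..n}) (restrict p {1..n}) z) = {q\<in>{1..k}. d q z \<ge> \<eta>}"
          by (simp add: \<tau>_def g)
        then show ?thesis
          using ne unfolding t_def step_template_edge_of[OF z] by (simp only: Let_def if_False)
      qed
      note ctx = hereditary c \<eta>0 less_imp_le[OF \<epsilon>0] f_def d_def reg[folded d_def] refl t
      have "real (card {e \<in> K_edges n. c e \<notin> t e}) \<le> real k * \<eta> * (real n)\<^sup>2"
        by (rule card_mismatches[OF ctx])
      also have "\<dots> \<le> real k * \<eta> * (4 * real (n choose 2))"
        using \<eta>0 n by (intro mult_left_mono square_le_binomial) auto
      also have "\<dots> \<le> \<gamma> * real (n choose 2)"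
        using mult_right_mono[OF \<eta>1, of "real (n choose 2)"] by simp
      finally have edits: "real (card {e \<in> K_edges n. c e \<notin> t e}) \<le> \<gamma> * real (n choose 2)" .
      have "real (card (bad_pairs k P m n t)) \<le> K * (real k * \<eta> + \<epsilon> / \<eta> ^ ?D) * real n ^ m"
        unfolding K_def by (rule card_bad_pairs_le[OF ctx])
      also have "\<dots> \<le> K * (real k * \<eta> + \<epsilon> / \<eta> ^ ?D) * (M * real (n choose m))"
        unfolding M_def using \<eta>0 \<epsilon>0 K0 n by (intro mult_left_mono power_le_binomial) auto
      also have "\<dots> = (K * (real k * \<eta>) * M + K * (\<epsilon> / \<eta> ^ ?D) * M) * real (n choose m)"
        by (simp add: algebra_simps)
      also have "\<dots> \<le> \<delta> * real (n choose m)"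
        using add_mono[OF \<eta>2 \<epsilon>1] by (intro mult_right_mono) auto
      finally show ?thesis
        using tF edits by blast
    qed
    then show ?thesis
      using cardF F by blast
  qed
  then show ?thesis by blast
qed

section \<open>Entropy\<close>

lemma realisations_eq_PiE:
  assumes "t \<in> templates k n"
  shows "realisations k n t = (\<Pi>\<^sub>E e\<in>K_edges n. t e)"
proof -
  have "t e \<subseteq> {1..k}" if "e \<in> K_edges n" for e
    using assms that by (auto simp: templates_def dest!: PiE_mem)
  then show ?thesis
    by (auto simp: realisations_def colourings_def PiE_def Pi_def subset_iff)
qed

lemma template_palette:
  assumes "t \<in> templates k n" "e \<in> K_edges n"
  shows "t e \<subseteq> {1..k}" "t e \<noteq> {}" "finite (t e)" "1 \<le> card (t e)"
proof -
  show *: "t e \<subseteq> {1..k}" "t e \<noteq> {}"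
    using assms by (auto simp: templates_def dest!: PiE_mem)
  then show "finite (t e)"
    using finite_subset by blast
  then show "1 \<le> card (t e)"
    using * by (simp add: card_gt_0_iff Suc_leI)
qed

lemma Ent_nonneg:
  assumes "t \<in> templates k n" "1 \<le> k"
  shows "0 \<le> Ent k n t"
proof -
  have "0 \<le> log (real k) (real (card (t e)))" if "e \<in> K_edges n" for e
    using template_palette(4)[OF assms(1) that] assms(2) by (simp add: log_def)
  then show ?thesis
    unfolding Ent_def by (rule sum_nonneg)
qed

lemma card_realisations:
  assumes t: "t \<in> templates k n" and "2 \<le> k"
  shows "real (card (realisations k n t)) = real k powr Ent k n t"
proof -
  have "real (card (realisations k n t)) = (\<Prod>e\<in>K_edges n. real (card (t e)))"
    by (simp add: realisations_eq_PiE[OF t] card_PiE)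
  also have "\<dots> = (\<Prod>e\<in>K_edges n. real k powr log (real k) (real (card (t e))))"
  proof (rule prod.cong[OF refl])
    fix e assume "e \<in> K_edges n"
    then show "real (card (t e)) = real k powr log (real k) (real (card (t e)))"
      using template_palette(4)[OF t] assms(2) by (subst powr_log_cancel) fastforce+
  qed
  also have "\<dots> = real k powr Ent k n t"
    using assms(2) by (simp add: Ent_def powr_sum)
  finally show ?thesis .
qed

section \<open>Restriction of templates along order injections\<close>

lemma K_edges_image:
  assumes "inj_on \<phi> {1..m}"
  shows "image \<phi> ` K_edges m = {e. e \<subseteq> \<phi> ` {1..m} \<and> card e = 2}" (is "?L = ?R")
proof
  show "?L \<subseteq> ?R"
    using assms by (auto simp: K_edges_def card_image[OF inj_on_subset])
  show "?R \<subseteq> ?L"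
  proof
    fix e assume e: "e \<in> ?R"
    then obtain e' where e': "e' \<subseteq> {1..m}" "e = \<phi> ` e'"
      by (auto elim: subset_imageE)
    then have "card e' = 2"
      using e card_image[OF inj_on_subset[OF assms e'(1)]] by simp
    then show "e \<in> ?L"
      using e' by (auto simp: K_edges_def)
  qed
qed

lemma inj_on_image_K_edges:
  assumes "inj_on \<phi> {1..m}"
  shows "inj_on (image \<phi>) (K_edges m)"
  by (rule inj_on_subset[OF inj_on_image_Pow[OF assms]]) (auto simp: K_edges_def)

lemma order_injection_image_edges:
  assumes "\<phi> \<in> order_injections m n" "e \<in> K_edges m"
  shows "\<phi> ` e \<in> K_edges n"
proof -
  have "inj_on \<phi> {1..m}" "\<phi> ` {1..m} \<subseteq> {1..n}"
    using assms(1) by (auto simp: order_injections_def)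
  moreover have "\<phi> ` e \<in> {e. e \<subseteq> \<phi> ` {1..m} \<and> card e = 2}"
    unfolding K_edges_image[OF calculation(1), symmetric] using assms(2) by (rule imageI)
  ultimately show ?thesis
    unfolding K_edges_def[of n] by blast
qed

lemma Ent_pullback:
  assumes "\<phi> \<in> order_injections m n"
  shows "Ent k m (pullback m \<phi> t) = (\<Sum>e\<in>image \<phi> ` K_edges m. log (real k) (real (card (t e))))"
proof -
  have "inj_on \<phi> {1..m}"
    using assms by (simp add: order_injections_def)
  then show ?thesis
    by (simp add: Ent_def pullback_def sum.reindex[OF inj_on_image_K_edges])
qed

lemma pullback_template:
  assumes "\<phi> \<in> order_injections m n" "t \<in> templates k n"
  shows "pullback m \<phi> t \<in> templates k m"
  using template_palette(1,2)[OF assms(2)] order_injection_image_edges[OF assms(1)]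
  by (auto simp: pullback_def templates_def)

text \<open>A realisation of the restricted template extends to one of \<open>t\<close> by taking
  any palette colour on the edges outside the image; heredity then brings it back to
  \<open>P m\<close>.\<close>

lemma realisations_pullback_subset:
  assumes hereditary: "order_hereditary k P" and \<phi>: "\<phi> \<in> order_injections m n"
    and t: "t \<in> templates k n" "realisations k n t \<subseteq> P n"
  shows "realisations k m (pullback m \<phi> t) \<subseteq> P m"
proof
  fix c assume "c \<in> realisations k m (pullback m \<phi> t)"
  then have c: "c \<in> (\<Pi>\<^sub>E e\<in>K_edges m. pullback m \<phi> t e)"
    by (simp add: realisations_eq_PiE[OF pullback_template[OF \<phi> t(1)]])
  have inj: "inj_on (image \<phi>) (K_edges m)"
    using \<phi> by (intro inj_on_image_K_edges) (simp add: order_injections_def)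
  define c' where "c' = (\<lambda>e\<in>K_edges n. if e \<in> image \<phi> ` K_edges m
    then c (the_inv_into (K_edges m) (image \<phi>) e) else (SOME q. q \<in> t e))"
  have "c' e \<in> t e" if e: "e \<in> K_edges n" for e
  proof (cases "e \<in> image \<phi> ` K_edges m")
    case True
    then obtain e' where e': "e' \<in> K_edges m" "e = \<phi> ` e'" by blast
    then show ?thesis
      using PiE_mem[OF c e'(1)] e by (simp add: c'_def the_inv_into_f_f[OF inj] pullback_def)
  next
    case False
    then show ?thesis
      using template_palette(2)[OF t(1) e] e by (simp add: c'_def some_in_eq)
  qed
  then have "c' \<in> realisations k n t"
    by (simp add: realisations_eq_PiE[OF t(1)] PiE_iff c'_def)
  then have "pullback m \<phi> c' \<in> P m"
    using hereditary \<phi> t(2) unfolding order_hereditary_def by blast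
  moreover have "pullback m \<phi> c' = c"
  proof (rule extensionalityI[of _ "K_edges m"])
    show "pullback m \<phi> c' \<in> extensional (K_edges m)" "c \<in> extensional (K_edges m)"
      using c by (auto simp: pullback_def PiE_def)
    show "pullback m \<phi> c' e = c e" if "e \<in> K_edges m" for e
      using that order_injection_image_edges[OF \<phi> that]
      by (simp add: pullback_def c'_def the_inv_into_f_f[OF inj])
  qed
  ultimately show "c \<in> P m" by simp
qed

lemma as_template_realisations:
  assumes "c \<in> colourings k n"
  shows "as_template n c \<in> templates k n" "realisations k n (as_template n c) = {c}"
proof -
  show *: "as_template n c \<in> templates k n"
    using assms by (auto simp: as_template_def templates_def colourings_def dest: PiE_mem)
  show "realisations k n (as_template n c) = {c}"
    using assms PiE_singleton[of c "K_edges n"] PiE_cong[of "K_edges n" "as_template n c" "\<lambda>e. {c e}"]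
    unfolding realisations_eq_PiE[OF *] by (simp add: as_template_def colourings_def PiE_def)
qed

section \<open>Extremal entropy and its limiting density\<close>

lemma finite_admissible_entropies:
  "finite {Ent k n t | t. t \<in> templates k n \<and> realisations k n t \<subseteq> P n}"
  by (rule finite_subset[of _ "Ent k n ` templates k n"]) auto

lemma Ent_le_ex_ent:
  assumes "t \<in> templates k n" "realisations k n t \<subseteq> P n"
  shows "Ent k n t \<le> ex_ent k P n"
  unfolding ex_ent_def using assms by (intro Max_ge finite_admissible_entropies) blast

lemma ex_ent_attained:
  assumes "order_hereditary k P" "P n \<noteq> {}"
  obtains t where "t \<in> templates k n" "realisations k n t \<subseteq> P n" "Ent k n t = ex_ent k P n"
proof -
  obtain c where "c \<in> P n" "c \<in> colourings k n"
    using assms unfolding order_hereditary_def by blast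
  then have "{Ent k n t | t. t \<in> templates k n \<and> realisations k n t \<subseteq> P n} \<noteq> {}"
    using as_template_realisations[of c k n] by force
  from Max_in[OF finite_admissible_entropies[of k n P] this] show thesis
    unfolding ex_ent_def[symmetric] using that by auto
qed

lemma skip_vertex_injection:
  assumes "v \<in> {1..Suc n}"
  obtains \<phi> where "\<phi> \<in> order_injections n (Suc n)"
    "image \<phi> ` K_edges n = {e \<in> K_edges (Suc n). v \<notin> e}"
proof
  define \<phi> where "\<phi> = (\<lambda>i\<in>{1..n}. if i < v then i else Suc i)"
  have inj: "inj_on \<phi> {1..n}"
    by (auto simp: \<phi>_def inj_on_def split: if_splits)
  show "\<phi> \<in> order_injections n (Suc n)"
    using inj by (auto simp: order_injections_def \<phi>_def mono_on_def split: if_splits)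
  have "\<phi> ` {1..n} = {1..Suc n} - {v}"
  proof
    show "\<phi> ` {1..n} \<subseteq> {1..Suc n} - {v}"
      by (auto simp: \<phi>_def)
    show "{1..Suc n} - {v} \<subseteq> \<phi> ` {1..n}"
    proof
      fix i assume i: "i \<in> {1..Suc n} - {v}"
      show "i \<in> \<phi> ` {1..n}"
      proof (cases "i < v")
        case True
        then show ?thesis
          using i assms by (intro image_eqI[of _ _ i]) (auto simp: \<phi>_def)
      next
        case False
        then show ?thesis
          using i assms by (intro image_eqI[of _ _ "i - 1"]) (auto simp: \<phi>_def)
      qed
    qed
  qed
  then show "image \<phi> ` K_edges n = {e \<in> K_edges (Suc n). v \<notin> e}"
    unfolding K_edges_image[OF inj] by (auto simp: K_edges_def)
qed

text \<open>Delete each of the n + 1 vertices in turn from an optimal template. Every edge survives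
  all deletions except those of its two ends, hence n - 1 of them, and each remaining template is
  admissible on n vertices.\<close>

lemma ex_ent_averaging:
  assumes hereditary: "order_hereditary k P" and ne: "\<And>n. P n \<noteq> {}"
  shows "real (n - 1) * ex_ent k P (Suc n) \<le> real (Suc n) * ex_ent k P n"
proof -
  obtain t where t: "t \<in> templates k (Suc n)" "realisations k (Suc n) t \<subseteq> P (Suc n)"
    and ent: "Ent k (Suc n) t = ex_ent k P (Suc n)"
    using ex_ent_attained[OF hereditary ne] .
  define w where "w e = log (real k) (real (card (t e)))" for e
  have "sum w {e \<in> K_edges (Suc n). v \<notin> e} \<le> ex_ent k P n" if v: "v \<in> {1..Suc n}" for v
  proof -
    obtain \<phi> where \<phi>: "\<phi> \<in> order_injections n (Suc n)"
      "image \<phi> ` K_edges n = {e \<in> K_edges (Suc n). v \<notin> e}"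
      using skip_vertex_injection[OF v] .
    have "sum w {e \<in> K_edges (Suc n). v \<notin> e} = Ent k n (pullback n \<phi> t)"
      unfolding Ent_pullback[OF \<phi>(1)] \<phi>(2) w_def ..
    then show ?thesis
      using Ent_le_ex_ent[where P = P, OF pullback_template[OF \<phi>(1) t(1)]
          realisations_pullback_subset[OF hereditary \<phi>(1) t]] by simp
  qed
  then have "(\<Sum>v\<in>{1..Suc n}. sum w {e \<in> K_edges (Suc n). v \<notin> e}) \<le> (\<Sum>v\<in>{1..Suc n}. ex_ent k P n)"
    by (rule sum_mono)
  moreover have "(\<Sum>v\<in>{1..Suc n}. sum w {e \<in> K_edges (Suc n). v \<notin> e}) = real (n - 1) * sum w (K_edges (Suc n))"
  proof -
    have "(\<Sum>v\<in>{1..Suc n}. sum w {e \<in> K_edges (Suc n). v \<notin> e})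
        = (\<Sum>e\<in>K_edges (Suc n). \<Sum>v | v \<in> {1..Suc n} \<and> v \<notin> e. w e)"
      by (rule sum.swap_restrict) auto
    also have "\<dots> = (\<Sum>e\<in>K_edges (Suc n). real (n - 1) * w e)"
    proof (rule sum.cong[OF refl])
      fix e assume "e \<in> K_edges (Suc n)"
      then have e: "e \<subseteq> {1..Suc n}" "card e = 2"
        by (auto simp: K_edges_def)
      have "card {v. v \<in> {1..Suc n} \<and> v \<notin> e} = card ({1..Suc n} - e)"
        by (rule arg_cong[where f = card]) auto
      also have "\<dots> = n - 1"
        using e card_Diff_subset[OF finite_subset[OF e(1)] e(1)] by simp
      finally show "(\<Sum>v | v \<in> {1..Suc n} \<and> v \<notin> e. w e) = real (n - 1) * w e"
        by simp
    qed
    finally show ?thesis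
      by (simp add: sum_distrib_left)
  qed
  ultimately show ?thesis
    using ent by (simp add: w_def Ent_def)
qed

lemma real_choose_2: "real (n choose 2) = real n * (real n - 1) / 2"
proof -
  have "even (n * (n - 1))" by (cases n) auto
  then show ?thesis
    by (cases n) (auto simp: choose_two real_of_nat_div field_simps)
qed

text \<open>By averaging, the normalised extremal entropies decrease, and they are nonnegative; so
  the \<open>lim\<close> in \<open>entropy_density\<close> is a genuine limit and lies below every
  term.\<close>

lemma entropy_density_le:
  assumes hereditary: "order_hereditary k P" and ne: "\<And>n. P n \<noteq> {}" and k: "1 \<le> k" and n: "2 \<le> n"
  shows "entropy_density k P * real (n choose 2) \<le> ex_ent k P n"
proof -
  define X where "X n = ex_ent k P n / real (n choose 2)" for n
  have "X (Suc n) \<le> X n" if "2 \<le> n" for n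
  proof -
    have "(real n - 1) * ex_ent k P (Suc n) \<le> (real n + 1) * ex_ent k P n"
      using ex_ent_averaging[OF hereditary ne, of n] that by (simp add: of_nat_diff add.commute)
    then have "ex_ent k P (Suc n) \<le> (real n + 1) * ex_ent k P n / (real n - 1)"
      using that by (simp add: pos_le_divide_eq mult.commute)
    also have "\<dots> = X n * real (Suc n choose 2)"
      using that unfolding X_def real_choose_2 by (simp add: field_simps)
    finally show ?thesis
      using that unfolding X_def[of "Suc n"]
      by (intro mult_imp_div_pos_le) (simp_all add: real_choose_2)
  qed
  \<comment> \<open>The shift by 2 skips n = 0 and n = 1, where the quotient divides by
    zero.\<close>
  then have dec: "decseq (\<lambda>n. X (n + 2))"
    by (intro decseq_SucI) simp
  have "0 \<le> X (n + 2)" for n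
  proof -
    obtain t where "t \<in> templates k (n + 2)" "Ent k (n + 2) t = ex_ent k P (n + 2)"
      using ex_ent_attained[OF hereditary ne] .
    then show ?thesis
      using Ent_nonneg[of t k "n + 2"] k by (simp add: X_def)
  qed
  then obtain L where L: "(\<lambda>n. X (n + 2)) \<longlonglongrightarrow> L" "\<And>i. L \<le> X (i + 2)"
    using decseq_convergent[OF dec, of 0] by blast
  have "X \<longlonglongrightarrow> L"
    by (rule LIMSEQ_offset[OF L(1)])
  then have "entropy_density k P = L"
    unfolding entropy_density_def X_def by (rule limI)
  then have "entropy_density k P \<le> X n"
    using L(2)[of "n - 2"] n by (simp only: le_add_diff_inverse2)
  moreover have "0 < real (n choose 2)"
    using n by (simp add: zero_less_binomial_iff)
  ultimately show ?thesis
    by (simp add: X_def pos_le_divide_eq)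
qed

text \<open>All realisations of an optimal template lie in \<open>P n\<close>.\<close>

lemma powr_entropy_density_le_card:
  assumes hereditary: "order_hereditary k P" and ne: "\<And>n. P n \<noteq> {}" and k: "2 \<le> k" and n: "2 \<le> n"
  shows "real k powr (entropy_density k P * real (n choose 2)) \<le> real (card (P n))"
proof -
  obtain t where t: "t \<in> templates k n" "realisations k n t \<subseteq> P n" "Ent k n t = ex_ent k P n"
    using ex_ent_attained[OF hereditary ne] .
  have "finite (P n)"
    using hereditary finite_subset[OF _ finite_colourings] unfolding order_hereditary_def by blast
  have "real k powr (entropy_density k P * real (n choose 2)) \<le> real k powr ex_ent k P n"
    using entropy_density_le[OF hereditary ne _ n] k by (intro powr_mono) auto
  also have "\<dots> = real (card (realisations k n t))"
    using card_realisations[OF t(1) k] t(3) by simp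
  also have "\<dots> \<le> real (card (P n))"
    using card_mono[OF \<open>finite (P n)\<close> t(2)] by simp
  finally show ?thesis .
qed

section \<open>Counting near realisations\<close>

text \<open>Rankin's trick: each mismatched edge is weighted by \<open>z\<close>.\<close>

lemma card_near_realisations:
  assumes t: "t \<in> templates k n" and k: "2 \<le> k" and z: "0 < z" "z \<le> 1"
  shows "real (card {c \<in> colourings k n. real (card {e \<in> K_edges n. c e \<notin> t e}) \<le> s})
    \<le> z powr (- s) * (1 + z * real k) ^ (n choose 2) * real k powr Ent k n t"
    (is "real (card ?X) \<le> _")
proof -
  define w where "w e q = (if q \<in> t e then 1 else z)" for e q
  have "real (card ?X) = (\<Sum>c\<in>?X. 1)" by simp
  \<comment> \<open>A counted colouring has b <= s mismatches and its product is z^b; as z <= 1, the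
    prefactor lifts this to at least 1.\<close>
  also have "\<dots> \<le> (\<Sum>c\<in>?X. z powr (- s) * (\<Prod>e\<in>K_edges n. w e (c e)))"
  proof (rule sum_mono)
    fix c assume c: "c \<in> ?X"
    let ?b = "card {e \<in> K_edges n. c e \<notin> t e}"
    have "(\<Prod>e\<in>K_edges n. w e (c e)) = (\<Prod>e\<in>{e \<in> K_edges n. c e \<notin> t e}. z)"
      by (rule prod.mono_neutral_cong_right) (auto simp: w_def)
    also have "\<dots> = z powr real ?b"
      using z by (simp add: powr_realpow)
    finally have "z powr (- s) * (\<Prod>e\<in>K_edges n. w e (c e)) = z powr (real ?b - s)"
      by (simp flip: powr_add)
    moreover have "1 \<le> z powr (real ?b - s)"
      using c z powr_mono'[of "real ?b - s" 0 z] by simp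
    ultimately show "1 \<le> z powr (- s) * (\<Prod>e\<in>K_edges n. w e (c e))"
      by simp
  qed
  also have "\<dots> \<le> (\<Sum>c\<in>colourings k n. z powr (- s) * (\<Prod>e\<in>K_edges n. w e (c e)))"
    using z by (intro sum_mono2 mult_nonneg_nonneg prod_nonneg) (auto simp: w_def)
  \<comment> \<open>Over all colourings the weighted sum factorises by edges. Each factor is at most
    |t e| + z k, and |t e| >= 1 absorbs the second term into (1 + z k) |t e|.\<close>
  also have "\<dots> = z powr (- s) * (\<Prod>e\<in>K_edges n. \<Sum>q\<in>{1..k}. w e q)"
    unfolding colourings_def by (simp add: prod_sum_PiE sum_distrib_left)
  also have "\<dots> \<le> z powr (- s) * (\<Prod>e\<in>K_edges n. (1 + z * real k) * real (card (t e)))"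
  proof (intro mult_left_mono prod_mono conjI)
    fix e assume e: "e \<in> K_edges n"
    note te = template_palette[OF t e]
    show "0 \<le> (\<Sum>q\<in>{1..k}. w e q)"
      using z by (intro sum_nonneg) (auto simp: w_def)
    have "(\<Sum>q\<in>{1..k}. w e q) \<le> (\<Sum>q\<in>{1..k}. of_bool (q \<in> t e) + z)"
      using z by (intro sum_mono) (auto simp: w_def)
    also have "\<dots> = real (card (t e)) + z * real k * 1"
      using te(1) by (simp add: sum.distrib Int_absorb1 mult.commute)
    also have "\<dots> \<le> real (card (t e)) + z * real k * real (card (t e))"
      using z te(4) by (intro add_left_mono mult_left_mono) auto
    finally show "(\<Sum>q\<in>{1..k}. w e q) \<le> (1 + z * real k) * real (card (t e))"
      by (simp add: algebra_simps)
  qed simp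
  also have "(\<Prod>e\<in>K_edges n. (1 + z * real k) * real (card (t e)))
      = (1 + z * real k) ^ (n choose 2) * (\<Prod>e\<in>K_edges n. real (card (t e)))"
    by (simp add: prod.distrib card_K_edges)
  also have "(\<Prod>e\<in>K_edges n. real (card (t e))) = real k powr Ent k n t"
    unfolding card_realisations[OF t k, symmetric] by (simp add: realisations_eq_PiE[OF t] card_PiE)
  finally show ?thesis by (simp add: mult.assoc)
qed

text \<open>Recolouring each mismatched edge from its palette turns \<open>c\<close> into a
  realisation of \<open>s\<close>.\<close>

lemma dist_to_family_le:
  assumes c: "c \<in> colourings k n" and s: "s \<in> S n" "s \<in> templates k n"
  shows "dist_to_family k n S c \<le> card {e \<in> K_edges n. c e \<notin> s e}"
proof -
  define c' where "c' = (\<lambda>e\<in>K_edges n. if c e \<in> s e then c e else (SOME q. q \<in> s e))"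
  have "c' \<in> realisations k n s"
    unfolding realisations_eq_PiE[OF s(2)]
    using template_palette(2)[OF s(2)] by (auto simp: c'_def some_in_eq)
  then have c': "c' \<in> family_realisations k S n"
    using s(1) by (auto simp: family_realisations_def)
  have "finite (family_realisations k S n)"
    by (rule finite_subset[OF _ finite_colourings[of k n]])
       (auto simp: family_realisations_def realisations_def)
  then have "dist_to_family k n S c \<le> edit_dist n (as_template n c') (as_template n c)"
    using c' unfolding dist_to_family_def by (auto intro!: Min_le)
  also have "\<dots> \<le> card {e \<in> K_edges n. c e \<notin> s e}"
    unfolding edit_dist_def by (intro card_mono) (auto simp: as_template_def c'_def)
  finally show ?thesis .
qed

lemma card_mismatch_triangle:
  "card {e \<in> K_edges n. c e \<notin> s e} \<le> card {e \<in> K_edges n. c e \<notin> t e} + edit_dist n s t"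
proof -
  have "card {e \<in> K_edges n. c e \<notin> s e}
      \<le> card ({e \<in> K_edges n. c e \<notin> t e} \<union> {e \<in> K_edges n. s e \<noteq> t e})"
    by (intro card_mono) auto
  also have "\<dots> \<le> card {e \<in> K_edges n. c e \<notin> t e} + edit_dist n s t"
    unfolding edit_dist_def by (rule card_Un_le)
  finally show ?thesis .
qed

section \<open>Choice of constants and the final count\<close>

lemma container_count_negligible:
  assumes "0 < \<epsilon>" "0 < a"
  shows "\<exists>n0. \<forall>n\<ge>n0. real (R ^ n * C) \<le> \<epsilon> * exp (a * real (n choose 2))"
proof -
  \<comment> \<open>\<open>exp l\<close> absorbs C / \<epsilon>. The \<open>+ 1\<close> keeps the
    argument of \<open>ln\<close> positive when \<open>C = 0\<close>, and the absolute value ensures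
    l <= n l.\<close>
  define l where "l = \<bar>ln ((real C + 1) / \<epsilon>)\<bar>"
  \<comment> \<open>Solves n (R + l) <= a n (n - 1) / 2, where R^n is estimated by exp (n
    R).\<close>
  obtain n0 :: nat where n0: "1 + 2 * (real R + l) / a \<le> real n0"
    using real_arch_simple by blast
  have "real (R ^ n * C) \<le> \<epsilon> * exp (a * real (n choose 2))" if n: "n \<ge> Suc n0" for n
  proof -
    have "2 * (real R + l) / a \<le> real n - 1"
      using n n0 by linarith
    then have "real R + l \<le> a * (real n - 1) / 2"
      using \<open>0 < a\<close> by (simp add: field_simps)
    then have "real n * (real R + l) \<le> real n * (a * (real n - 1) / 2)"
      by (intro mult_left_mono) auto
    then have "real n * real R + real n * l \<le> a * real (n choose 2)"
      by (simp add: real_choose_2 algebra_simps)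
    moreover have "1 * l \<le> real n * l"
      using n by (intro mult_right_mono) (auto simp: l_def)
    ultimately have *: "real n * real R + l \<le> a * real (n choose 2)"
      by simp
    have "real R \<le> exp (real R)"
      using exp_ge_add_one_self[of "real R"] by linarith
    then have "real R ^ n \<le> exp (real n * real R)"
      unfolding exp_of_nat_mult by (intro power_mono) auto
    moreover have "real C \<le> \<epsilon> * exp l"
    proof -
      have "(real C + 1) / \<epsilon> = exp (ln ((real C + 1) / \<epsilon>))"
        using \<open>0 < \<epsilon>\<close> by (simp add: add_nonneg_pos)
      also have "\<dots> \<le> exp l"
        by (simp add: l_def)
      finally show ?thesis
        using \<open>0 < \<epsilon>\<close> by (simp add: field_simps)
    qed
    ultimately have "real R ^ n * real C \<le> exp (real n * real R) * (\<epsilon> * exp l)"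
      by (intro mult_mono) auto
    also have "\<dots> = \<epsilon> * exp (real n * real R + l)"
      by (simp add: exp_add)
    also have "\<dots> \<le> \<epsilon> * exp (a * real (n choose 2))"
      using * \<open>0 < \<epsilon>\<close> by simp
    finally show ?thesis by simp
  qed
  then show ?thesis by blast
qed

text \<open>Makes the overhead in \<open>card_near_realisations\<close> harmless. First z is taken
  so small that (1 + z k)^N costs half the exponent; only then \<gamma>, small against 1 / l with l
  = - ln z, so that z^(- \<gamma> N) costs the other half. The cap 1/2 on z keeps l
  positive.\<close>

lemma near_realisation_slack:
  assumes k: "2 \<le> (k::nat)" and "0 < \<delta>" "0 < \<epsilon>"
  obtains z \<gamma> :: real where "0 < z" "z \<le> 1" "0 < \<gamma>" "\<gamma> \<le> \<epsilon>"
    "\<And>N. z powr (- (\<gamma> * real N)) * (1 + z * real k) ^ N \<le> exp (\<delta> * real N)"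
proof -
  define z where "z = min (1/2) (\<delta> / (2 * real k))"
  have z: "0 < z" "z < 1"
    using assms by (auto simp: z_def)
  have "z \<le> \<delta> / (2 * real k)"
    by (simp add: z_def)
  then have zk: "z * real k \<le> \<delta> / 2"
    using k by (simp add: field_simps)
  define l where "l = - ln z"
  have lz: "0 < l"
    using z by (simp add: l_def)
  define \<gamma> where "\<gamma> = min \<epsilon> (\<delta> / (2 * l))"
  have \<gamma>: "0 < \<gamma>"
    using assms lz by (simp add: \<gamma>_def)
  have "\<gamma> \<le> \<delta> / (2 * l)"
    by (simp add: \<gamma>_def)
  then have \<gamma>z: "\<gamma> * l \<le> \<delta> / 2"
    using lz by (simp add: field_simps)
  have "z powr (- (\<gamma> * real N)) * (1 + z * real k) ^ N \<le> exp (\<delta> * real N)" for N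
  proof -
    have "z powr (- (\<gamma> * real N)) = exp (real N * (\<gamma> * l))"
      using z by (simp add: powr_def l_def algebra_simps)
    also have "\<dots> \<le> exp (real N * (\<delta> / 2))"
      using \<gamma>z by (simp only: exp_le_cancel_iff) (intro mult_left_mono, auto)
    finally have 1: "z powr (- (\<gamma> * real N)) \<le> exp (real N * (\<delta> / 2))" .
    have "1 + z * real k \<le> exp (\<delta> / 2)"
      using exp_ge_add_one_self[of "\<delta> / 2"] zk by linarith
    then have 2: "(1 + z * real k) ^ N \<le> exp (real N * (\<delta> / 2))"
      unfolding exp_of_nat_mult using z by (intro power_mono) auto
    have "z powr (- (\<gamma> * real N)) * (1 + z * real k) ^ N \<le> exp (real N * (\<delta> / 2)) * exp (real N * (\<delta> / 2))"
      using z by (intro mult_mono 1 2) auto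
    also have "\<dots> = exp (\<delta> * real N)"
      by (simp flip: exp_add add: algebra_simps)
    finally show ?thesis .
  qed
  then show thesis
    using that[of z \<gamma>] z \<gamma> by (simp add: \<gamma>_def)
qed

text \<open>If the template of a far colouring had high entropy, stability would place a member of
  \<open>S n\<close> within \<epsilon> / 2 of it, and the colouring within \<gamma> + \<epsilon> / 2
  <= \<epsilon>. So low-entropy templates already cover the far colourings. The gap \<delta>
  precedes \<gamma>, since the final count needs \<gamma> small in terms of \<delta>.\<close>

lemma far_from_family_low_entropy:
  assumes hereditary: "order_hereditary k P" and k: "1 \<le> k" and S: "stability_family k P S"
    and "0 < \<epsilon>"
  obtains \<delta> where "0 < \<delta>"
    "\<And>\<gamma>. 0 < \<gamma> \<Longrightarrow> \<gamma> \<le> \<epsilon> / 2 \<Longrightarrow> \<exists>R C n0. \<forall>n\<ge>n0. \<exists>F \<subseteq> templates k n. card F \<le> R ^ n * C \<and>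
      (\<forall>t\<in>F. Ent k n t < (entropy_density k P - \<delta>) * real (n choose 2)) \<and>
      {c \<in> P n. real (dist_to_family k n S c) > \<epsilon> * real (n choose 2)}
        \<subseteq> (\<Union>t\<in>F. {c \<in> colourings k n. real (card {e \<in> K_edges n. c e \<notin> t e}) \<le> \<gamma> * real (n choose 2)})"
proof -
  have "0 < \<epsilon> / 2" using \<open>0 < \<epsilon>\<close> by simp
  then obtain \<delta> m n1 where "0 < \<delta>" and stable: "\<And>n t. n \<ge> n1 \<Longrightarrow> t \<in> templates k n \<Longrightarrow>
        Ent k n t \<ge> (entropy_density k P - \<delta>) * real (n choose 2) \<Longrightarrow>
        real (card (bad_pairs k P m n t)) \<le> \<delta> * real (n choose m) \<Longrightarrow>
        \<exists>s \<in> S n. real (edit_dist n s t) \<le> \<epsilon> / 2 * real (n choose 2)"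
    using S unfolding stability_family_def by meson
  have ST: "\<And>n. S n \<subseteq> templates k n"
    using S unfolding stability_family_def by blast
  have "\<exists>R C n0. \<forall>n\<ge>n0. \<exists>F \<subseteq> templates k n. card F \<le> R ^ n * C \<and>
      (\<forall>t\<in>F. Ent k n t < (entropy_density k P - \<delta>) * real (n choose 2)) \<and>
      {c \<in> P n. real (dist_to_family k n S c) > \<epsilon> * real (n choose 2)}
        \<subseteq> (\<Union>t\<in>F. {c \<in> colourings k n. real (card {e \<in> K_edges n. c e \<notin> t e}) \<le> \<gamma> * real (n choose 2)})"
    if \<gamma>: "0 < \<gamma>" "\<gamma> \<le> \<epsilon> / 2" for \<gamma>
  proof -
    obtain R where R: "\<And>n. n \<ge> max m 2 \<Longrightarrow> \<exists>F \<subseteq> templates k n. card F \<le> R ^ n * 2 ^ (k * (R * R)) \<and>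
      (\<forall>c\<in>P n. \<exists>t\<in>F. real (card {e \<in> K_edges n. c e \<notin> t e}) \<le> \<gamma> * real (n choose 2) \<and>
        real (card (bad_pairs k P m n t)) \<le> \<delta> * real (n choose m))"
      using container_theorem[OF hereditary k \<open>0 < \<delta>\<close> \<gamma>(1)] by blast
    show ?thesis
    proof (rule exI[of _ R], rule exI[of _ "2 ^ (k * (R * R))"], rule exI[of _ "max n1 (max m 2)"], intro allI impI)
      fix n assume n: "n \<ge> max n1 (max m 2)"
      then obtain F where F: "F \<subseteq> templates k n" "card F \<le> R ^ n * 2 ^ (k * (R * R))"
        and cover: "\<And>c. c \<in> P n \<Longrightarrow> \<exists>t\<in>F. real (card {e \<in> K_edges n. c e \<notin> t e}) \<le> \<gamma> * real (n choose 2) \<and>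
          real (card (bad_pairs k P m n t)) \<le> \<delta> * real (n choose m)"
        using R[of n] by auto
      let ?low = "{t\<in>F. Ent k n t < (entropy_density k P - \<delta>) * real (n choose 2)}"
      have "\<exists>t\<in>?low. c \<in> {c \<in> colourings k n. real (card {e \<in> K_edges n. c e \<notin> t e}) \<le> \<gamma> * real (n choose 2)}"
        if c: "c \<in> P n" "real (dist_to_family k n S c) > \<epsilon> * real (n choose 2)" for c
      proof -
        have col: "c \<in> colourings k n"
          using hereditary c(1) unfolding order_hereditary_def by blast
        obtain t where t: "t \<in> F" "real (card {e \<in> K_edges n. c e \<notin> t e}) \<le> \<gamma> * real (n choose 2)"
          "real (card (bad_pairs k P m n t)) \<le> \<delta> * real (n choose m)"
          using cover[OF c(1)] by blast
        have "Ent k n t < (entropy_density k P - \<delta>) * real (n choose 2)"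
        proof (rule ccontr)
          assume "\<not> ?thesis"
          then obtain s where s: "s \<in> S n" "real (edit_dist n s t) \<le> \<epsilon> / 2 * real (n choose 2)"
            using stable[of n t] t F(1) n by auto
          have "real (dist_to_family k n S c) \<le> real (card {e \<in> K_edges n. c e \<notin> s e})"
            using dist_to_family_le[where S = S, OF col s(1)] ST s(1) by fastforce
          also have "\<dots> \<le> real (card {e \<in> K_edges n. c e \<notin> t e}) + real (edit_dist n s t)"
            using card_mismatch_triangle[of n c s t] by linarith
          also have "\<dots> \<le> \<gamma> * real (n choose 2) + \<epsilon> / 2 * real (n choose 2)"
            using t(2) s(2) by linarith
          also have "\<dots> \<le> \<epsilon> / 2 * real (n choose 2) + \<epsilon> / 2 * real (n choose 2)"
            using \<gamma>(2) by (intro add_right_mono mult_right_mono) auto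
          finally show False
            using c(2) by simp
        qed
        then show ?thesis
          using t col by blast
      qed
      moreover have "card ?low \<le> R ^ n * 2 ^ (k * (R * R))"
        using F(2) card_mono[OF finite_subset[OF F(1) finite_templates], of ?low] by auto
      ultimately show "\<exists>F \<subseteq> templates k n. card F \<le> R ^ n * 2 ^ (k * (R * R)) \<and>
        (\<forall>t\<in>F. Ent k n t < (entropy_density k P - \<delta>) * real (n choose 2)) \<and>
        {c \<in> P n. real (dist_to_family k n S c) > \<epsilon> * real (n choose 2)}
          \<subseteq> (\<Union>t\<in>F. {c \<in> colourings k n. real (card {e \<in> K_edges n. c e \<notin> t e}) \<le> \<gamma> * real (n choose 2)})"
        using F(1) by (intro exI[of _ ?low]) auto
    qed
  qed
  then show thesis
    using that \<open>0 < \<delta>\<close> by blast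
qed

theorem theorem2p18:
  fixes k :: nat
    and P :: "nat \<Rightarrow> colouring set"
    and S :: "nat \<Rightarrow> template set"
  assumes "order_hereditary k P"
    and "\<And>n. P n \<noteq> {}"
    and "stability_family k P S"
  shows "\<forall>\<epsilon>>0. \<exists>n0. \<forall>n\<ge>n0.
    real (card {c \<in> P n. real (dist_to_family k n S c) > \<epsilon> * real (n choose 2)})
      \<le> \<epsilon> * real (card (P n))"
proof (intro allI impI)
  fix \<epsilon> :: real assume \<epsilon>: "0 < \<epsilon>"
  define Far where "Far n = {c \<in> P n. real (dist_to_family k n S c) > \<epsilon> * real (n choose 2)}" for n
  define \<pi> where "\<pi> = entropy_density k P"
  define Near where "Near \<gamma> n t = {c \<in> colourings k n.
    real (card {e \<in> K_edges n. c e \<notin> t e}) \<le> \<gamma> * real (n choose 2)}" for \<gamma> n t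
  have k: "1 \<le> k"
  proof (rule ccontr)
    assume "\<not> 1 \<le> k"
    moreover have "{1, 2} \<in> K_edges 2"
      by (auto simp: K_edges_def)
    ultimately have "colourings k 2 = {}"
      by (auto simp: colourings_def PiE_eq_empty_iff)
    then show False
      using assms(1) assms(2)[of 2] unfolding order_hereditary_def by blast
  qed
  obtain \<delta> where \<delta>: "0 < \<delta>"
    and containers: "\<And>\<gamma>. 0 < \<gamma> \<Longrightarrow> \<gamma> \<le> \<epsilon> / 2 \<Longrightarrow> \<exists>R C n0. \<forall>n\<ge>n0. \<exists>F \<subseteq> templates k n.
      card F \<le> R ^ n * C \<and> (\<forall>t\<in>F. Ent k n t < (\<pi> - \<delta>) * real (n choose 2)) \<and> Far n \<subseteq> (\<Union>t\<in>F. Near \<gamma> n t)"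
    using far_from_family_low_entropy[OF assms(1) k assms(3) \<epsilon>] unfolding Far_def \<pi>_def Near_def by blast
  have "\<exists>n0. \<forall>n\<ge>n0. real (card (Far n)) \<le> \<epsilon> * real (card (P n))"
  proof (cases "k = 1")
    case True
    \<comment> \<open>\<open>log 1 x = 0\<close> by division by zero, so every template has entropy \<open>0\<close> here\<close>
    have Ent0: "Ent k n t = 0" for n t
      using True by (simp add: Ent_def log_def)
    obtain t where "t \<in> templates k 2" "Ent k 2 t = ex_ent k P 2"
      using ex_ent_attained[OF assms(1,2)] .
    then have "\<pi> \<le> 0"
      using entropy_density_le[OF assms(1,2) k, of 2] Ent0[of 2 t] by (simp add: \<pi>_def)
    then have low: "(\<pi> - \<delta>) * real (n choose 2) \<le> 0" for n
      using \<delta> by (intro mult_nonpos_nonneg) auto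
    have "0 < \<epsilon> / 2" using \<epsilon> by simp
    from containers[OF this order_refl] obtain R C n0 where containers0: "\<forall>n\<ge>n0. \<exists>F \<subseteq> templates k n.
        card F \<le> R ^ n * C \<and> (\<forall>t\<in>F. Ent k n t < (\<pi> - \<delta>) * real (n choose 2)) \<and>
        Far n \<subseteq> (\<Union>t\<in>F. Near (\<epsilon> / 2) n t)"
      by (elim exE)
    have "Far n = {}" if n: "n \<ge> n0" for n
    proof -
      obtain F where F: "\<forall>t\<in>F. Ent k n t < (\<pi> - \<delta>) * real (n choose 2)"
        "Far n \<subseteq> (\<Union>t\<in>F. Near (\<epsilon> / 2) n t)"
        using containers0[rule_format, OF n] by (elim exE conjE)
      \<comment> \<open>Every entropy is 0 and the threshold is at most 0, so no template lies
        strictly below it.\<close>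
      have "F = {}"
        using F(1) low[of n] unfolding Ent0 by force
      with F(2) show ?thesis by simp
    qed
    then have "\<forall>n\<ge>n0. real (card (Far n)) \<le> \<epsilon> * real (card (P n))"
      using \<epsilon> by simp
    then show ?thesis ..
  next
    case False
    then have k2: "2 \<le> k" using k by simp
    define \<Lambda> where "\<Lambda> = ln (real k)"
    have \<Lambda>: "0 < \<Lambda>" using k2 by (simp add: \<Lambda>_def)
    have kpowr: "real k powr x = exp (\<Lambda> * x)" for x
      using k2 by (simp add: powr_def \<Lambda>_def mult.commute)
    \<comment> \<open>In natural logarithms the entropy deficit is \<delta> \<Lambda> N. One half
      pays for the edits, the other for the number of templates.\<close>
    have "0 < \<delta> * \<Lambda> / 2" "0 < \<epsilon> / 2" using \<delta> \<Lambda> \<epsilon> by auto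
    from near_realisation_slack[OF k2 this] obtain z \<gamma> where z: "0 < z" "z \<le> 1"
      and \<gamma>: "0 < \<gamma>" "\<gamma> \<le> \<epsilon> / 2"
      and slack: "\<And>N. z powr (- (\<gamma> * real N)) * (1 + z * real k) ^ N \<le> exp (\<delta> * \<Lambda> / 2 * real N)"
      by blast
    obtain R C n1 where F: "\<And>n. n \<ge> n1 \<Longrightarrow> \<exists>F \<subseteq> templates k n.
      card F \<le> R ^ n * C \<and> (\<forall>t\<in>F. Ent k n t < (\<pi> - \<delta>) * real (n choose 2)) \<and> Far n \<subseteq> (\<Union>t\<in>F. Near \<gamma> n t)"
      using containers[OF \<gamma>] by meson
    obtain n2 where n2: "\<And>n. n \<ge> n2 \<Longrightarrow> real (R ^ n * C) \<le> \<epsilon> * exp (\<delta> * \<Lambda> / 2 * real (n choose 2))"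
      using container_count_negligible[OF \<epsilon> \<open>0 < \<delta> * \<Lambda> / 2\<close>] by blast
    have "real (card (Far n)) \<le> \<epsilon> * real (card (P n))" if n: "n \<ge> max 2 (max n1 n2)" for n
    proof -
      define N where "N = real (n choose 2)"
      obtain F where F: "F \<subseteq> templates k n" "card F \<le> R ^ n * C"
        "\<And>t. t \<in> F \<Longrightarrow> Ent k n t < (\<pi> - \<delta>) * N" "Far n \<subseteq> (\<Union>t\<in>F. Near \<gamma> n t)"
        using F[of n] n unfolding N_def by auto
      have finF: "finite F"
        by (rule finite_subset[OF F(1) finite_templates])
      have near: "real (card (Near \<gamma> n t)) \<le> exp (\<delta> * \<Lambda> / 2 * N) * exp (\<Lambda> * ((\<pi> - \<delta>) * N))" if t: "t \<in> F" for t
      proof -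
        have "real (card (Near \<gamma> n t))
            \<le> z powr (- (\<gamma> * N)) * (1 + z * real k) ^ (n choose 2) * real k powr Ent k n t"
          unfolding Near_def N_def using card_near_realisations[OF _ k2 z] F(1) t by blast
        also have "\<dots> \<le> exp (\<delta> * \<Lambda> / 2 * N) * exp (\<Lambda> * ((\<pi> - \<delta>) * N))"
          using slack[of "n choose 2"] F(3)[OF t] \<Lambda> unfolding N_def kpowr
          by (intro mult_mono) auto
        finally show ?thesis .
      qed
      have "card (Far n) \<le> card (\<Union>t\<in>F. Near \<gamma> n t)"
        by (rule card_mono[OF _ F(4)]) (use finF in \<open>auto simp: Near_def\<close>)
      also have "\<dots> \<le> (\<Sum>t\<in>F. card (Near \<gamma> n t))"
        by (rule card_UN_le[OF finF])
      finally have "real (card (Far n)) \<le> (\<Sum>t\<in>F. real (card (Near \<gamma> n t)))"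
        by (simp flip: of_nat_sum)
      also have "\<dots> \<le> (\<Sum>t\<in>F. exp (\<delta> * \<Lambda> / 2 * N) * exp (\<Lambda> * ((\<pi> - \<delta>) * N)))"
        by (intro sum_mono near)
      also have "\<dots> = real (card F) * (exp (\<delta> * \<Lambda> / 2 * N) * exp (\<Lambda> * ((\<pi> - \<delta>) * N)))"
        by simp
      also have "\<dots> \<le> (\<epsilon> * exp (\<delta> * \<Lambda> / 2 * N)) * (exp (\<delta> * \<Lambda> / 2 * N) * exp (\<Lambda> * ((\<pi> - \<delta>) * N)))"
      proof (rule mult_right_mono)
        have "real (card F) \<le> real (R ^ n * C)"
          using F(2) of_nat_mono by blast
        then show "real (card F) \<le> \<epsilon> * exp (\<delta> * \<Lambda> / 2 * N)"
          using n2[of n] n unfolding N_def by simp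
      qed simp
      \<comment> \<open>The two halves cancel the deficit exactly, leaving k^(\<pi> N), the lower
        bound for |P n|.\<close>
      also have "\<dots> = \<epsilon> * exp (\<Lambda> * (\<pi> * N))"
        by (simp add: mult.assoc flip: exp_add) (simp add: algebra_simps)
      also have "\<dots> \<le> \<epsilon> * real (card (P n))"
        using powr_entropy_density_le_card[OF assms(1,2) k2, of n] n \<epsilon>
        unfolding kpowr \<pi>_def N_def by (intro mult_left_mono) auto
      finally show ?thesis .
    qed
    then show ?thesis by blast
  qed
  then show "\<exists>n0. \<forall>n\<ge>n0. real (card {c \<in> P n. real (dist_to_family k n S c) > \<epsilon> * real (n choose 2)})
      \<le> \<epsilon> * real (card (P n))"
    unfolding Far_def .
qed

end
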